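(* Let $(\mathcal{X}_1,\mathcal{X}_2,p(y_2|x_1)p(y_3|x_1,x_2,y_2),\mathcal{Y}_2,\mathcal{Y}_3)$ be a discrete memoryless noncausal relay channel with capacity $C_\infty$. Then \[ C_{\infty} \geq \max \min\{I(X_1;U,Y_3),\; I(X_1,U;Y_3)-I(U;Y_2|X_1)\}, \] where the maximum is over all pmfs $p(x_1)p(u|y_2)$ (with $U$ taking values in a finite set) and all functions $x_2(u,y_2)$, and the mutual informations are evaluated under the joint distribution $p(x_1)p(y_2|x_1)p(u|y_2)\mathbf{1}\{x_2=x_2(u,y_2)\}p(y_3|x_1,x_2,y_2)$.
   Context: A discrete memoryless (DM) noncausal relay channel consists of finite alphabets $\mathcal{X}_1,\mathcal{X}_2,\mathcal{Y}_2,\mathcal{Y}_3$ and conditional pmfs $p(y_2|x_1)$ and $p(y_3|x_1,x_2,y_2)$; the sender inputs $X_1$, the relay observes $Y_2$ and inputs $X_2$, the receiver observes $Y_3$. It is memoryless: $p(y_{2i}|x_1^i,y_2^{i-1},m)=p(y_{2i}|x_{1i})$ and $p(y_{3i}|x_1^i,x_2^i,y_2^i,y_3^{i-1},m)=p(y_{3i}|x_{1i},x_{2i},y_{2i})$. A $(2^{nR},n)$ code consists of a message set $[1:2^{nR}]$, an encoder assigning a codeword $x_1^n(m)$ to each message $m$, a relay encoder assigning a symbol $x_{2i}(y_2^n)$ for each $i\in[1:n]$ as a function of the entire received sequence $y_2^n$ (noncausal, i.e., unlimited lookahead), and a decoder assigning an estimate $\hat m(y_3^n)$ or an error. The message $M$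 is uniform over $[1:2^{nR}]$, the error probability is $P_e^{(n)}=\mathbb{P}\{\hat M\neq M\}$, a rate $R$ is achievable if there is a sequence of $(2^{nR},n)$ codes with $P_e^{(n)}\to 0$, and the capacity $C_\infty$ is the supremum of achievable rates. *)

theory Defs
  imports "HOL-Probability.Probability"
begin

definition mutual_info :: "'a pmf \<Rightarrow> ('a \<Rightarrow> 'b::finite) \<Rightarrow> ('a \<Rightarrow> 'c::finite) \<Rightarrow> real" where
  "mutual_info P X Y =
     (\<Sum>b\<in>UNIV. \<Sum>c\<in>UNIV.
        let pbc = pmf (map_pmf (\<lambda>a. (X a, Y a)) P) (b, c);
            pb = pmf (map_pmf X P) b;
            pc = pmf (map_pmf Y P) c
        in if pbc = 0 then 0 else pbc * log 2 (pbc / (pb * pc)))"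

definition cond_mutual_info ::
  "'a pmf \<Rightarrow> ('a \<Rightarrow> 'b::finite) \<Rightarrow> ('a \<Rightarrow> 'c::finite) \<Rightarrow> ('a \<Rightarrow> 'd::finite) \<Rightarrow> real" where
  "cond_mutual_info P X Y Z =
     (\<Sum>b\<in>UNIV. \<Sum>c\<in>UNIV. \<Sum>d\<in>UNIV.
        let pbcd = pmf (map_pmf (\<lambda>a. (X a, Y a, Z a)) P) (b, c, d);
            pbd = pmf (map_pmf (\<lambda>a. (X a, Z a)) P) (b, d);
            pcd = pmf (map_pmf (\<lambda>a. (Y a, Z a)) P) (c, d);
            pd = pmf (map_pmf Z P) d
        in if pbcd = 0 then 0 else pbcd * log 2 (pbcd * pd / (pbd * pcd)))"

definition relay_joint ::
  "('x1 \<Rightarrow> 'y2 pmf) \<Rightarrow> ('x1 \<Rightarrow> 'x2 \<Rightarrow> 'y2 \<Rightarrow> 'y3 pmf) \<Rightarrow> 'x1 pmf \<Rightarrow> ('y2 \<Rightarrow> 'u pmf)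
    \<Rightarrow> ('u \<Rightarrow> 'y2 \<Rightarrow> 'x2) \<Rightarrow> ('x1 \<times> 'y2 \<times> 'u \<times> 'x2 \<times> 'y3) pmf" where
  "relay_joint W2 W3 px1 pu f =
     bind_pmf px1 (\<lambda>x1. bind_pmf (W2 x1) (\<lambda>y2. bind_pmf (pu y2) (\<lambda>u.
       map_pmf (\<lambda>y3. (x1, y2, u, f u y2, y3)) (W3 x1 (f u y2) y2))))"

(* Error probability of a (M, n) code for the DM noncausal relay channel.
   enc m i = x_{1i}(m); rel y2 i = x_{2i}(y2^n) (depends on the whole length-n sequence y2^n);
   dec y3 = estimate of the message (any value outside [1:M] counts as an error).
   Message uniform on [1:M]. *)
definition relay_error ::
  "('x1 \<Rightarrow> 'y2::finite pmf) \<Rightarrow> ('x1 \<Rightarrow> 'x2 \<Rightarrow> 'y2 \<Rightarrow> 'y3::finite pmf) \<Rightarrow> nat \<Rightarrow> nat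
    \<Rightarrow> (nat \<Rightarrow> nat \<Rightarrow> 'x1) \<Rightarrow> ('y2 list \<Rightarrow> nat \<Rightarrow> 'x2) \<Rightarrow> ('y3 list \<Rightarrow> nat) \<Rightarrow> real" where
  "relay_error W2 W3 n M enc rel dec =
     (1 / real M) * (\<Sum>m\<in>{1..M}.
        \<Sum>y2\<in>{ys. length ys = n}. \<Sum>y3\<in>{ys. length ys = n}.
          (\<Prod>i<n. pmf (W2 (enc m i)) (y2 ! i)) *
          (\<Prod>i<n. pmf (W3 (enc m i) (rel y2 i) (y2 ! i)) (y3 ! i)) *
          (if dec y3 = m then 0 else 1))"

definition num_messages :: "real \<Rightarrow> nat \<Rightarrow> nat" where
  "num_messages R n = nat \<lceil>2 powr (real n * R)\<rceil>"

definition relay_achievable ::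
  "('x1 \<Rightarrow> 'y2::finite pmf) \<Rightarrow> ('x1 \<Rightarrow> 'x2 \<Rightarrow> 'y2 \<Rightarrow> 'y3::finite pmf) \<Rightarrow> real \<Rightarrow> bool" where
  "relay_achievable W2 W3 R \<longleftrightarrow> 0 \<le> R \<and>
     (\<exists>(enc :: nat \<Rightarrow> nat \<Rightarrow> nat \<Rightarrow> 'x1) (rel :: nat \<Rightarrow> 'y2 list \<Rightarrow> nat \<Rightarrow> 'x2)
        (dec :: nat \<Rightarrow> 'y3 list \<Rightarrow> nat).
        (\<lambda>n. relay_error W2 W3 n (num_messages R n) (enc n) (rel n) (dec n)) \<longlonglongrightarrow> 0)"

definition relay_capacity ::
  "('x1 \<Rightarrow> 'y2::finite pmf) \<Rightarrow> ('x1 \<Rightarrow> 'x2 \<Rightarrow> 'y2 \<Rightarrow> 'y3::finite pmf) \<Rightarrow> ereal" where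
  "relay_capacity W2 W3 = Sup (ereal ` {R. relay_achievable W2 W3 R})"

end

theory Submission
  imports Defs
begin

text \<open>
  The sender uses a random codebook \<open>x1(m)\<close> of rate \<open>R\<close>, the relay an independent random codebook
  \<open>u(l)\<close> of rate slightly above \<open>I(U;Y2)\<close>. If the relay picked \<open>l\<close> with probability proportional to
  \<open>p(u(l)|y2) / p(u(l))\<close>, then, up to the soft-covering error, \<open>(X1, Y2, U(L), Y3)\<close> would follow
  the target product law with all other codewords independent of it; no Markov lemma is needed. The
  decoder looks for the unique \<open>m\<close> for which some \<open>l\<close> makes the information densities of
  \<open>(x1(m), u(l), y3)\<close> large. A wrong \<open>m\<close> with the right \<open>l\<close> is excluded by \<open>R < I(X1;U,Y3)\<close>, a wrong
  pair by \<open>R + I(U;Y2) < I(X1,U;Y3) + I(X1;U)\<close>, which is the second bound because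
  \<open>I(U;Y2) - I(X1;U) = I(U;Y2|X1)\<close>. All of this is a one-shot inequality between finite sums; for
  sequences, the tail terms decay exponentially by Chernoff's bound.
\<close>

subsection \<open>Random codebooks and soft covering\<close>

text \<open>The obstacle: the index that the relay picks depends on \<open>y2\<close> and on the
  whole codebook, so under an actual relay rule the transmitted word and the remaining words are
  dependent. That law is never analysed. For each fixed \<open>l\<close> the codebook is weighted by
  the likelihood ratio at word \<open>l\<close> over \<open>L\<close>; this weight touches no other
  relay word, so false alarms are computed with independent words. The weights sum to a number near
  1 instead of 1, and the covering deviation pays for the gap. Only this payment asks for a large
  relay codebook; only the union bound over wrong pairs asks for a small one. The two tests differ
  in what stays correlated. A wrong message word next to the transmitted relay word is compared with
  p(x)p(u,z); a wrong pair is compared with p(x)p(u)p(z), because the two codebooks are independent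
  of each other. This is the source of the extra I(X1;U). A wrong relay word next to the right
  message is no error, hence no third constraint on the rates.\<close>

definition iid_mean :: "'i set \<Rightarrow> 'a set \<Rightarrow> ('a \<Rightarrow> real) \<Rightarrow> (('i \<Rightarrow> 'a) \<Rightarrow> real) \<Rightarrow> real" where
  "iid_mean I A p F = (\<Sum>c\<in>PiE I (\<lambda>_. A). (\<Prod>i\<in>I. p (c i)) * F c)"

lemma iid_mean_add: "iid_mean I A p (\<lambda>c. F c + G c) = iid_mean I A p F + iid_mean I A p G"
  by (simp add: iid_mean_def distrib_left sum.distrib)

lemma iid_mean_cmult: "iid_mean I A p (\<lambda>c. r * F c) = r * iid_mean I A p F"
  by (simp add: iid_mean_def sum_distrib_left mult_ac)

lemma iid_mean_sum: "iid_mean I A p (\<lambda>c. \<Sum>s\<in>S. F s c) = (\<Sum>s\<in>S. iid_mean I A p (F s))"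
  unfolding iid_mean_def sum_distrib_left by (rule sum.swap)

lemma iid_mean_mono:
  assumes "\<And>a. 0 \<le> p a" "\<And>c. c \<in> PiE I (\<lambda>_. A) \<Longrightarrow> F c \<le> G c"
  shows "iid_mean I A p F \<le> iid_mean I A p G"
  unfolding iid_mean_def using assms by (intro sum_mono mult_left_mono prod_nonneg) auto

lemma iid_mean_single:
  assumes "finite I" "finite A" "(\<Sum>a\<in>A. p a) = 1" "i \<in> I"
  shows "iid_mean I A p (\<lambda>c. h (c i)) = (\<Sum>a\<in>A. p a * h a)"
proof -
  have "iid_mean I A p (\<lambda>c. h (c i))
      = (\<Sum>c\<in>PiE I (\<lambda>_. A). \<Prod>j\<in>I. p (c j) * (if j = i then h (c j) else 1))"
    unfolding iid_mean_def using assms by (intro sum.cong) (auto simp: prod.distrib prod.delta)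
  also have "\<dots> = (\<Prod>j\<in>I. \<Sum>a\<in>A. p a * (if j = i then h a else 1))"
    using assms by (subst prod_sum_PiE) auto
  also have "\<dots> = (\<Prod>j\<in>I. if j = i then \<Sum>a\<in>A. p a * h a else 1)"
    using assms by (intro prod.cong) auto
  finally show ?thesis using assms by simp
qed

lemma iid_mean_const:
  assumes "finite I" "finite A" "(\<Sum>a\<in>A. p a) = 1"
  shows "iid_mean I A p (\<lambda>c. r) = r"
proof -
  have "(\<Sum>c\<in>PiE I (\<lambda>_. A). \<Prod>j\<in>I. p (c j)) = (\<Prod>j\<in>I. \<Sum>a\<in>A. p a)"
    using assms by (subst prod_sum_PiE) auto
  then show ?thesis
    using assms unfolding iid_mean_def by (simp flip: sum_distrib_right)
qed

text \<open>A function of two coordinates is not a product over coordinates. Summing over the value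
  \<open>b\<close> of coordinate \<open>j\<close>, with an indicator, makes every summand such a
  product, and \<open>prod_sum_PiE\<close> applies for each \<open>b\<close>.\<close>

lemma iid_mean_pair:
  assumes "finite I" "finite A" "(\<Sum>a\<in>A. p a) = 1" "i \<in> I" "j \<in> I" "i \<noteq> j"
  shows "iid_mean I A p (\<lambda>c. h (c i) (c j)) = (\<Sum>a\<in>A. \<Sum>b\<in>A. p a * p b * h a b)"
proof -
  have "iid_mean I A p (\<lambda>c. h (c i) (c j))
      = (\<Sum>c\<in>PiE I (\<lambda>_. A). \<Sum>b\<in>A. \<Prod>k\<in>I. p (c k) *
          ((if k = i then h (c k) b else 1) * (if k = j then of_bool (c k = b) else 1)))"
    unfolding iid_mean_def
  proof (rule sum.cong[OF refl])
    fix c assume c: "c \<in> PiE I (\<lambda>_. A)"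
    have "(\<Sum>b\<in>A. \<Prod>k\<in>I. p (c k) *
          ((if k = i then h (c k) b else 1) * (if k = j then of_bool (c k = b) else 1)))
        = (\<Sum>b\<in>A. if b = c j then (\<Prod>k\<in>I. p (c k)) * h (c i) b else 0)"
      using assms by (intro sum.cong) (auto simp: prod.distrib prod.delta)
    also have "\<dots> = (\<Prod>k\<in>I. p (c k)) * h (c i) (c j)"
      using assms c by (auto simp: sum.delta)
    finally show "(\<Prod>k\<in>I. p (c k)) * h (c i) (c j) = (\<Sum>b\<in>A. \<Prod>k\<in>I. p (c k) *
          ((if k = i then h (c k) b else 1) * (if k = j then of_bool (c k = b) else 1)))" ..
  qed
  also have "\<dots> = (\<Sum>b\<in>A. \<Sum>c\<in>PiE I (\<lambda>_. A). \<Prod>k\<in>I. p (c k) *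
          ((if k = i then h (c k) b else 1) * (if k = j then of_bool (c k = b) else 1)))"
    by (rule sum.swap)
  also have "\<dots> = (\<Sum>b\<in>A. \<Sum>a\<in>A. p a * p b * h a b)"
  proof (rule sum.cong[OF refl])
    fix b assume b: "b \<in> A"
    have "(\<Sum>c\<in>PiE I (\<lambda>_. A). \<Prod>k\<in>I. p (c k) *
          ((if k = i then h (c k) b else 1) * (if k = j then of_bool (c k = b) else 1)))
        = (\<Prod>k\<in>I. \<Sum>a\<in>A. p a *
          ((if k = i then h a b else 1) * (if k = j then of_bool (a = b) else 1)))"
      using assms by (subst prod_sum_PiE) auto
    also have "\<dots> = (\<Prod>k\<in>I. (if k = i then \<Sum>a\<in>A. p a * h a b else 1) * (if k = j then p b else 1))"
      using assms b by (intro prod.cong) (auto simp: of_bool_def if_distrib[of "\<lambda>t. _ * t"] sum.delta cong: if_cong)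
    also have "\<dots> = (\<Sum>a\<in>A. p a * h a b) * p b"
      using assms by (simp add: prod.distrib prod.delta)
    finally show "(\<Sum>c\<in>PiE I (\<lambda>_. A). \<Prod>k\<in>I. p (c k) *
          ((if k = i then h (c k) b else 1) * (if k = j then of_bool (c k = b) else 1)))
        = (\<Sum>a\<in>A. p a * p b * h a b)"
      by (simp add: sum_distrib_left mult_ac)
  qed
  also have "\<dots> = (\<Sum>a\<in>A. \<Sum>b\<in>A. p a * p b * h a b)"
    by (rule sum.swap)
  finally show ?thesis .
qed

lemma iid_mean_le_imp_ex:
  assumes "finite I" "finite A" "(\<Sum>a\<in>A. p a) = 1" "\<And>a. 0 \<le> p a" "iid_mean I A p F \<le> r"
  shows "\<exists>c\<in>PiE I (\<lambda>_. A). F c \<le> r"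
proof (rule ccontr)
  assume "\<not> ?thesis"
  then have gt: "r < F c" if "c \<in> PiE I (\<lambda>_. A)" for c
    using that by force
  let ?w = "\<lambda>c. \<Prod>i\<in>I. p (c i)"
  have fin: "finite (PiE I (\<lambda>_. A))"
    using assms by (intro finite_PiE) auto
  have one: "(\<Sum>c\<in>PiE I (\<lambda>_. A). ?w c) = 1"
    using iid_mean_const[OF assms(1-3), of 1] by (simp add: iid_mean_def)
  \<comment> \<open>Strictness of the averaged inequality needs a codebook of positive weight; total
    weight 1 supplies it.\<close>
  then obtain c0 where c0: "c0 \<in> PiE I (\<lambda>_. A)" "?w c0 \<noteq> 0"
    by (metis (no_types, lifting) sum.neutral zero_neq_one)
  have w0: "0 \<le> ?w c" for c
    by (intro prod_nonneg) (use assms in auto)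
  have "(\<Sum>c\<in>PiE I (\<lambda>_. A). ?w c * r) < (\<Sum>c\<in>PiE I (\<lambda>_. A). ?w c * F c)"
    using c0 w0 gt fin
    by (intro sum_strict_mono_ex1) (auto intro!: mult_left_mono bexI[of _ c0] simp: less_le)
  then show False
    using assms(5) one unfolding iid_mean_def by (simp flip: sum_distrib_right)
qed

text \<open>Truncating \<open>k\<close> at level \<open>a\<close> leaves a summand of second moment at most \<open>a\<close>, to which
  Chebyshev's argument applies; what is cut off is charged to the tail twice.\<close>

lemma soft_covering:
  fixes p k :: "'a \<Rightarrow> real" and L :: nat
  assumes A: "finite A" "(\<Sum>x\<in>A. p x) = 1" "\<And>x. 0 \<le> p x"
    and k: "\<And>x. 0 \<le> k x" "(\<Sum>x\<in>A. p x * k x) = 1"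
    and a: "0 < a" and L: "0 < L"
  shows "iid_mean {1..L} A p (\<lambda>d. \<bar>1 - (\<Sum>l\<in>{1..L}. k (d l)) / L\<bar>)
    \<le> sqrt (a / L) + 2 * (\<Sum>x\<in>A. p x * k x * of_bool (k x > a))"
proof -
  define k1 where "k1 x = k x * of_bool (k x \<le> a)" for x
  define k2 where "k2 x = k x * of_bool (k x > a)" for x
  define \<mu> where "\<mu> = (\<Sum>x\<in>A. p x * k1 x)"
  define \<nu> where "\<nu> = (\<Sum>x\<in>A. p x * k2 x)"
  \<comment> \<open>Centring at the truncated mean \<open>\<mu>\<close> and not at 1 is what makes
    the cross terms vanish; the gap \<open>1 - \<mu> = \<nu>\<close> is paid separately.\<close>
  define h where "h x = k1 x - \<mu>" for x
  define s where "s = sqrt (a / L)"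
  have s: "0 < s" "s\<^sup>2 = a / L"
    using a L by (auto simp: s_def)
  have k12: "k x = k1 x + k2 x" for x
    by (auto simp: k1_def k2_def)
  have one: "\<mu> + \<nu> = 1"
    using k(2) by (simp add: k12 \<mu>_def \<nu>_def distrib_left sum.distrib)
  have k1n: "0 \<le> k1 x" and k2n: "0 \<le> k2 x" for x
    using k by (auto simp: k1_def k2_def)
  have \<mu>0: "0 \<le> \<mu>" and \<nu>0: "0 \<le> \<nu>"
    unfolding \<mu>_def \<nu>_def using A k1n k2n by (auto intro!: sum_nonneg)
  note E = iid_mean_single[OF finite_atLeastAtMost A(1,2)]
    and EE = iid_mean_pair[OF finite_atLeastAtMost A(1,2)]
  have Eh0: "(\<Sum>x\<in>A. p x * h x) = 0"
    using A(2) by (simp add: h_def right_diff_distrib sum_subtractf \<mu>_def flip: sum_distrib_right)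
  have Eh2: "(\<Sum>x\<in>A. p x * (h x * h x)) \<le> a"
  proof -
    have "(\<Sum>x\<in>A. p x * (h x * h x)) = (\<Sum>x\<in>A. p x * (k1 x)\<^sup>2 - 2 * \<mu> * (p x * k1 x) + \<mu>\<^sup>2 * p x)"
      by (intro sum.cong) (auto simp: h_def power2_eq_square algebra_simps)
    also have "\<dots> = (\<Sum>x\<in>A. p x * (k1 x)\<^sup>2) - 2 * \<mu> * \<mu> + \<mu>\<^sup>2 * (\<Sum>x\<in>A. p x)"
      by (simp add: sum.distrib sum_subtractf \<mu>_def sum_distrib_left)
    also have "\<dots> \<le> (\<Sum>x\<in>A. p x * (k1 x)\<^sup>2)"
      using A(2) by (simp add: power2_eq_square)
    also have "\<dots> \<le> (\<Sum>x\<in>A. p x * (a * k1 x))"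
      using A k1n by (intro sum_mono mult_left_mono)
        (auto simp: k1_def power2_eq_square intro!: mult_right_mono k)
    also have "\<dots> = a * \<mu>"
      by (simp add: \<mu>_def sum_distrib_left mult_ac)
    also have "\<dots> \<le> a * 1"
      using a one \<nu>0 by (intro mult_left_mono) auto
    finally show ?thesis by simp
  qed
  have pt: "\<bar>1 - (\<Sum>l\<in>{1..L}. k (d l)) / L\<bar>
      \<le> (1 / (2 * s * L\<^sup>2)) * (\<Sum>l\<in>{1..L}. \<Sum>l'\<in>{1..L}. h (d l) * h (d l')) + (s / 2 + \<nu>)
        + 1 / L * (\<Sum>l\<in>{1..L}. k2 (d l))" for d :: "nat \<Rightarrow> 'a"
  proof -
    define t where "t = (\<Sum>l\<in>{1..L}. h (d l)) / L"
    define v where "v = (\<Sum>l\<in>{1..L}. k2 (d l)) / L"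
    have v: "0 \<le> v"
      unfolding v_def using k2n by (auto intro!: divide_nonneg_nonneg sum_nonneg)
    have "(\<Sum>l\<in>{1..L}. k (d l)) = (\<Sum>l\<in>{1..L}. h (d l)) + L * \<mu> + (\<Sum>l\<in>{1..L}. k2 (d l))"
      by (simp add: k12 h_def sum.distrib sum_subtractf)
    \<comment> \<open>Here \<open>\<nu>\<close> enters as the mass missing from the truncated mean;
      it enters again as the mean of \<open>v\<close>.\<close>
    then have "1 - (\<Sum>l\<in>{1..L}. k (d l)) / L = \<nu> - t - v"
      using L one by (simp add: t_def v_def add_divide_distrib algebra_simps)
    then have "\<bar>1 - (\<Sum>l\<in>{1..L}. k (d l)) / L\<bar> \<le> \<bar>t\<bar> + \<nu> + v"
      using v \<nu>0 by linarith
    \<comment> \<open>Young's inequality instead of E|t| <= sqrt(E t^2): it is linear in t^2, so the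
      codebook mean can be taken term by term. With E t^2 <= s^2 the weight \<open>s\<close>
      balances the two halves at s/2 each.\<close>
    moreover have "\<bar>t\<bar> \<le> t\<^sup>2 / (2 * s) + s / 2"
    proof -
      have "0 \<le> (\<bar>t\<bar> - s)\<^sup>2 / (2 * s)"
        using s by simp
      also have "\<dots> = t\<^sup>2 / (2 * s) + s / 2 - \<bar>t\<bar>"
        using s(1) by (simp add: power2_diff field_simps power2_eq_square)
      finally show ?thesis by simp
    qed
    moreover have "t\<^sup>2 / (2 * s) = (1 / (2 * s * L\<^sup>2)) * (\<Sum>l\<in>{1..L}. \<Sum>l'\<in>{1..L}. h (d l) * h (d l'))"
      by (simp add: t_def power2_eq_square flip: sum_product)
    ultimately show ?thesis
      by (simp add: v_def)
  qed
  \<comment> \<open>Distinct codewords are independent and \<open>h\<close> is centred, so only the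
    \<open>L\<close> diagonal terms survive. This turns the second moment \<open>a\<close> into the
    variance a/L of the average.\<close>
  have cross: "iid_mean {1..L} A p (\<lambda>d. h (d l) * h (d l')) \<le> (if l' = l then a else 0)"
    if "l \<in> {1..L}" "l' \<in> {1..L}" for l l'
  proof (cases "l = l'")
    case True
    then show ?thesis using E[where i = l and h = "\<lambda>x. h x * h x"] that Eh2 by simp
  next
    case False
    have "iid_mean {1..L} A p (\<lambda>d. h (d l) * h (d l')) = (\<Sum>x\<in>A. \<Sum>y\<in>A. p x * p y * (h x * h y))"
      using EE[where i = l and j = l' and h = "\<lambda>x y. h x * h y"] that False by simp
    also have "\<dots> = (\<Sum>x\<in>A. p x * h x) * (\<Sum>y\<in>A. p y * h y)"
      unfolding sum_product by (simp add: mult_ac)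
    finally show ?thesis using Eh0 False by simp
  qed
  have Ek2: "iid_mean {1..L} A p (\<lambda>d. k2 (d l)) = \<nu>" if "l \<in> {1..L}" for l
    unfolding \<nu>_def by (rule E[OF that])
  have "iid_mean {1..L} A p (\<lambda>d. \<bar>1 - (\<Sum>l\<in>{1..L}. k (d l)) / L\<bar>)
      \<le> iid_mean {1..L} A p (\<lambda>d. (1 / (2 * s * L\<^sup>2)) * (\<Sum>l\<in>{1..L}. \<Sum>l'\<in>{1..L}. h (d l) * h (d l')) + (s / 2 + \<nu>)
        + 1 / L * (\<Sum>l\<in>{1..L}. k2 (d l)))"
    using A pt by (intro iid_mean_mono)
  also have "\<dots> = (1 / (2 * s * L\<^sup>2)) * (\<Sum>l\<in>{1..L}. \<Sum>l'\<in>{1..L}. iid_mean {1..L} A p (\<lambda>d. h (d l) * h (d l')))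
        + (s / 2 + \<nu>) + 1 / L * (\<Sum>l\<in>{1..L}. iid_mean {1..L} A p (\<lambda>d. k2 (d l)))"
    unfolding iid_mean_add iid_mean_cmult iid_mean_sum iid_mean_const[OF finite_atLeastAtMost A(1,2)] ..
  also have "\<dots> \<le> (1 / (2 * s * L\<^sup>2)) * (\<Sum>l\<in>{1..L}. \<Sum>l'\<in>{1..L}. if l' = l then a else 0)
        + (s / 2 + \<nu>) + 1 / L * (\<Sum>l\<in>{1..L}. \<nu>)"
    using s cross Ek2 by (intro add_mono mult_left_mono sum_mono) auto
  also have "\<dots> = s\<^sup>2 / (2 * s) + s / 2 + 2 * \<nu>"
    using L s by (simp add: sum.delta' power2_eq_square)
  also have "\<dots> = s + 2 * \<nu>"
    using s(1) by (simp add: power2_eq_square)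
  finally show ?thesis
    by (simp add: s_def \<nu>_def k2_def mult.assoc)
qed

text \<open>A relay choosing \<open>l\<close> with probability proportional to the likelihood ratio \<open>k l\<close> would meet
  this bound; a minimizer of \<open>\<psi>\<close> is deterministic and does at least as well.\<close>

lemma lower_bound_le_weighted_mean:
  fixes k \<psi> :: "nat \<Rightarrow> real"
  assumes "\<And>l. 0 \<le> k l" "\<And>l. l \<in> {1..L} \<Longrightarrow> s \<le> \<psi> l" "0 \<le> s" "s \<le> b" "0 < L"
  shows "s \<le> (\<Sum>l\<in>{1..L}. 1 / L * (k l * \<psi> l)) + b * \<bar>1 - (\<Sum>l\<in>{1..L}. k l) / L\<bar>"
proof -
  define D where "D = (\<Sum>l\<in>{1..L}. k l) / L"
  have "s * D = (\<Sum>l\<in>{1..L}. 1 / L * (k l * s))"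
    by (simp add: D_def sum_distrib_left sum_divide_distrib mult_ac)
  also have "\<dots> \<le> (\<Sum>l\<in>{1..L}. 1 / L * (k l * \<psi> l))"
    using assms by (intro sum_mono mult_left_mono) auto
  finally have 1: "s * D \<le> (\<Sum>l\<in>{1..L}. 1 / L * (k l * \<psi> l))" .
  have "s * (1 - D) \<le> s * \<bar>1 - D\<bar>"
    using assms by (intro mult_left_mono) auto
  also have "\<dots> \<le> b * \<bar>1 - D\<bar>"
    using assms by (intro mult_right_mono) auto
  finally show ?thesis
    using 1 by (simp add: D_def algebra_simps)
qed

subsection \<open>A one-shot coding bound\<close>

text \<open>The alphabets are arbitrary finite sets, so that sets of sequences can take their place,
  and laws are real functions, so that product formulas can be inserted directly. Domination by
  \<open>pu\<close> is demanded only on triples of positive probability, which is all that the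
  marginal law of U can guarantee.\<close>

locale one_shot_relay =
  fixes X :: "'x set" and Y :: "'y set" and U :: "'u set" and Z :: "'z set"
    and p :: "'x \<Rightarrow> real" and W :: "'x \<Rightarrow> 'y \<Rightarrow> real" and q :: "'y \<Rightarrow> 'u \<Rightarrow> real"
    and V :: "'x \<Rightarrow> 'u \<Rightarrow> 'y \<Rightarrow> 'z \<Rightarrow> real" and pu :: "'u \<Rightarrow> real" and T :: "'x \<Rightarrow> 'u \<Rightarrow> 'z \<Rightarrow> bool"
  assumes fin: "finite X" "finite Y" "finite U" "finite Z"
    and nonneg: "\<And>x. 0 \<le> p x" "\<And>x y. 0 \<le> W x y" "\<And>y u. 0 \<le> q y u" "\<And>x u y z. 0 \<le> V x u y z"
      "\<And>u. 0 \<le> pu u"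
    and sum1: "(\<Sum>x\<in>X. p x) = 1" "\<And>x. (\<Sum>y\<in>Y. W x y) = 1" "\<And>y. (\<Sum>u\<in>U. q y u) = 1"
      "\<And>x u y. (\<Sum>z\<in>Z. V x u y z) = 1" "(\<Sum>u\<in>U. pu u) = 1"
    and abs_cont: "\<And>x y u. x \<in> X \<Longrightarrow> y \<in> Y \<Longrightarrow> u \<in> U \<Longrightarrow> p x * W x y * q y u \<noteq> 0 \<Longrightarrow> pu u \<noteq> 0"
begin

definition lr :: "'y \<Rightarrow> 'u \<Rightarrow> real" where
  "lr y u = q y u / pu u"

definition joint :: "'x \<Rightarrow> 'y \<Rightarrow> 'u \<Rightarrow> 'z \<Rightarrow> real" where
  "joint x y u z = p x * W x y * q y u * V x u y z"

definition mean :: "('x \<Rightarrow> 'y \<Rightarrow> 'u \<Rightarrow> 'z \<Rightarrow> real) \<Rightarrow> real" where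
  "mean \<phi> = (\<Sum>x\<in>X. \<Sum>y\<in>Y. \<Sum>u\<in>U. \<Sum>z\<in>Z. joint x y u z * \<phi> x y u z)"

text \<open>Averaged over \<open>x\<close> and \<open>u\<close> drawn independently, \<open>tilted\<close> restores the true joint law.\<close>

definition tilted :: "'x \<Rightarrow> 'u \<Rightarrow> ('z \<Rightarrow> real) \<Rightarrow> real" where
  "tilted x u \<phi> = (\<Sum>y\<in>Y. lr y u * (W x y * (\<Sum>z\<in>Z. V x u y z * \<phi> z)))"

lemma lr_nonneg: "0 \<le> lr y u"
  using nonneg by (simp add: lr_def)

text \<open>Weighting by \<open>lr\<close> turns an average under the codebook law into one under
  \<open>q y\<close>. The factor \<open>p x * W x y\<close> stays on both sides: at an unreachable
  output, \<open>q y\<close> may charge words with \<open>pu u = 0\<close>, where \<open>lr\<close>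
  is 0 by the convention for division.\<close>

lemma lr_change_of_measure:
  assumes "x \<in> X" "y \<in> Y"
  shows "p x * W x y * (\<Sum>u\<in>U. pu u * (lr y u * h u)) = p x * W x y * (\<Sum>u\<in>U. q y u * h u)"
  unfolding sum_distrib_left
proof (rule sum.cong[OF refl])
  fix u assume "u \<in> U"
  then show "p x * W x y * (pu u * (lr y u * h u)) = p x * W x y * (q y u * h u)"
    using abs_cont[OF assms, of u] by (cases "pu u = 0") (auto simp: lr_def)
qed

lemma tilted_mono: "(\<And>z. \<phi> z \<le> \<phi>' z) \<Longrightarrow> tilted x u \<phi> \<le> tilted x u \<phi>'"
  unfolding tilted_def using nonneg lr_nonneg by (intro sum_mono mult_left_mono) auto

lemma tilted_add: "tilted x u (\<lambda>z. \<phi> z + \<phi>' z) = tilted x u \<phi> + tilted x u \<phi>'"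
  by (simp add: tilted_def distrib_left sum.distrib)

lemma tilted_sum: "tilted x u (\<lambda>z. \<Sum>s\<in>S. \<phi> s z) = (\<Sum>s\<in>S. tilted x u (\<phi> s))"
  unfolding tilted_def sum_distrib_left
  by (rule trans[OF sum.cong[OF refl sum.swap] sum.swap])

lemma mean_tilted:
  "(\<Sum>x\<in>X. p x * (\<Sum>u\<in>U. pu u * tilted x u (\<phi> x u))) = mean (\<lambda>x y u z. \<phi> x u z)"
proof -
  have "p x * (\<Sum>u\<in>U. pu u * tilted x u (\<phi> x u))
      = (\<Sum>y\<in>Y. \<Sum>u\<in>U. \<Sum>z\<in>Z. joint x y u z * \<phi> x u z)" if "x \<in> X" for x
  proof -
    have "p x * (\<Sum>u\<in>U. pu u * tilted x u (\<phi> x u))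
        = (\<Sum>y\<in>Y. p x * W x y * (\<Sum>u\<in>U. pu u * (lr y u * (\<Sum>z\<in>Z. V x u y z * \<phi> x u z))))"
      unfolding tilted_def sum_distrib_left by (subst sum.swap) (simp add: mult_ac)
    also have "\<dots> = (\<Sum>y\<in>Y. p x * W x y * (\<Sum>u\<in>U. q y u * (\<Sum>z\<in>Z. V x u y z * \<phi> x u z)))"
      using that by (intro sum.cong refl lr_change_of_measure)
    finally show ?thesis
      by (simp add: joint_def sum_distrib_left mult_ac)
  qed
  then show ?thesis
    by (simp add: mean_def)
qed

text \<open>Soft covering at each output \<open>y\<close> with \<open>k = lr y\<close>. Its
  normalization can fail at unreachable outputs, so the estimate carries the weight
  \<open>p x * W x y\<close> throughout; the same change of measure turns the tail under
  \<open>pu\<close> into one under the joint law.\<close>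

lemma covering_bound:
  fixes M L :: nat
  assumes "0 < a" "0 < L" "m \<in> {1..M}"
  shows "iid_mean {1..M} X p (\<lambda>c. iid_mean {1..L} U pu
      (\<lambda>d. \<Sum>y\<in>Y. W (c m) y * \<bar>1 - (\<Sum>l\<in>{1..L}. lr y (d l)) / L\<bar>))
    \<le> sqrt (a / L) + 2 * mean (\<lambda>x y u z. of_bool (lr y u > a))"
proof -
  define D where "D y = iid_mean {1..L} U pu (\<lambda>d. \<bar>1 - (\<Sum>l\<in>{1..L}. lr y (d l)) / L\<bar>)" for y
  have D: "p x * W x y * D y
      \<le> p x * W x y * sqrt (a / L) + 2 * (p x * W x y * (\<Sum>u\<in>U. q y u * of_bool (lr y u > a)))"
    if xy: "x \<in> X" "y \<in> Y" for x y
  proof (cases "p x * W x y = 0")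
    case False
    have "(\<Sum>u\<in>U. pu u * lr y u) = 1"
      using lr_change_of_measure[OF xy, of "\<lambda>_. 1"] False sum1 by simp
    from soft_covering[OF fin(3) sum1(5) nonneg(5) lr_nonneg this assms(1,2)]
    have "D y \<le> sqrt (a / L) + 2 * (\<Sum>u\<in>U. pu u * (lr y u * of_bool (lr y u > a)))"
      by (simp add: D_def mult.assoc)
    then have "p x * W x y * D y
        \<le> p x * W x y * (sqrt (a / L) + 2 * (\<Sum>u\<in>U. pu u * (lr y u * of_bool (lr y u > a))))"
      using nonneg by (intro mult_left_mono) auto
    also have "\<dots> = p x * W x y * sqrt (a / L)
        + 2 * (p x * W x y * (\<Sum>u\<in>U. pu u * (lr y u * of_bool (lr y u > a))))"
      by (simp only: distrib_left mult.left_commute)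
    finally show ?thesis
      unfolding lr_change_of_measure[OF xy] .
  qed auto
  have "iid_mean {1..M} X p (\<lambda>c. iid_mean {1..L} U pu
      (\<lambda>d. \<Sum>y\<in>Y. W (c m) y * \<bar>1 - (\<Sum>l\<in>{1..L}. lr y (d l)) / L\<bar>))
      = iid_mean {1..M} X p (\<lambda>c. \<Sum>y\<in>Y. W (c m) y * D y)"
    by (simp add: iid_mean_sum iid_mean_cmult D_def)
  also have "\<dots> = (\<Sum>x\<in>X. p x * (\<Sum>y\<in>Y. W x y * D y))"
    by (rule iid_mean_single) (use assms fin sum1 in auto)
  also have "\<dots> = (\<Sum>x\<in>X. \<Sum>y\<in>Y. p x * W x y * D y)"
    by (simp add: sum_distrib_left mult.assoc)
  also have "\<dots> \<le> (\<Sum>x\<in>X. \<Sum>y\<in>Y. p x * W x y * sqrt (a / L)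
      + 2 * (p x * W x y * (\<Sum>u\<in>U. q y u * of_bool (lr y u > a))))"
    by (intro sum_mono D)
  also have "\<dots> = (\<Sum>x\<in>X. \<Sum>y\<in>Y. p x * W x y) * sqrt (a / L)
      + 2 * (\<Sum>x\<in>X. \<Sum>y\<in>Y. \<Sum>u\<in>U. p x * W x y * q y u * of_bool (lr y u > a))"
    by (simp only: sum.distrib sum_distrib_left sum_distrib_right mult.assoc)
  also have "(\<Sum>x\<in>X. \<Sum>y\<in>Y. p x * W x y) = 1"
    by (simp add: sum1 flip: sum_distrib_left)
  also have "(\<Sum>x\<in>X. \<Sum>y\<in>Y. \<Sum>u\<in>U. p x * W x y * q y u * of_bool (lr y u > a))
      = (\<Sum>x\<in>X. \<Sum>y\<in>Y. \<Sum>u\<in>U. p x * W x y * q y u * of_bool (lr y u > a) * (\<Sum>z\<in>Z. V x u y z))"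
    by (simp add: sum1)
  also have "\<dots> = mean (\<lambda>x y u z. of_bool (lr y u > a))"
    unfolding mean_def joint_def sum_distrib_left[of _ _ Z] by (simp only: mult_ac)
  finally show ?thesis by simp
qed

text \<open>Picking any candidate suffices, since a wrong candidate is an error in the union bound
  whether or not the true message also qualifies. If there is no candidate, the true pair has failed
  the test, so the arbitrary value of \<open>SOME\<close> is already accounted for.\<close>

definition dec :: "nat \<Rightarrow> nat \<Rightarrow> (nat \<Rightarrow> 'x) \<Rightarrow> (nat \<Rightarrow> 'u) \<Rightarrow> 'z \<Rightarrow> nat" where
  "dec M L c d z = (SOME m. m \<in> {1..M} \<and> (\<exists>l\<in>{1..L}. T (c m) (d l) z))"

text \<open>A union bound. The index that supports a wrong estimate is split into \<open>l\<close>
  itself and the rest, because only the word actually sent is correlated with \<open>z\<close> and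
  the two cases are measured by different laws.\<close>

lemma dec_error_le:
  assumes "m \<in> {1..M}" "l \<in> {1..L}"
  shows "of_bool (dec M L c d z \<noteq> m) \<le> (of_bool (\<not> T (c m) (d l) z)
    + (\<Sum>m'\<in>{1..M} - {m}. of_bool (T (c m') (d l) z))
    + (\<Sum>m'\<in>{1..M} - {m}. \<Sum>l'\<in>{1..L} - {l}. of_bool (T (c m') (d l') z)) :: real)"
    (is "_ \<le> ?A + ?B + ?C")
proof (rule ccontr)
  assume neg: "\<not> ?thesis"
  have nn: "0 \<le> ?A" "0 \<le> ?B" "0 \<le> ?C"
    by (auto intro!: sum_nonneg)
  have ne: "dec M L c d z \<noteq> m"
    using neg nn by (auto split: if_splits)
  have lt: "?A + ?B + ?C < 1"
    using neg ne by simp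
  have T: "T (c m) (d l) z"
  proof (rule ccontr)
    assume "\<not> T (c m) (d l) z"
    then have "?A = 1" by simp
    with lt nn show False by linarith
  qed
  define m' where "m' = dec M L c d z"
  have "m' \<in> {1..M} \<and> (\<exists>l\<in>{1..L}. T (c m') (d l) z)"
    unfolding m'_def dec_def by (rule someI[of _ m]) (use assms T in auto)
  then obtain l' where m': "m' \<in> {1..M}" and l': "l' \<in> {1..L}" "T (c m') (d l') z"
    by auto
  have mm: "m' \<in> {1..M} - {m}"
    using m' ne by (simp add: m'_def)
  show False
  proof (cases "l' = l")
    case True
    have "1 = (of_bool (T (c m') (d l) z) :: real)"
      using l' True by simp
    also have "\<dots> \<le> ?B"
      by (rule member_le_sum[OF mm]) auto
    finally show False using lt nn by linarith
  next
    case False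
    have "1 = (of_bool (T (c m') (d l') z) :: real)"
      using l' by simp
    also have "\<dots> \<le> (\<Sum>l'\<in>{1..L} - {l}. of_bool (T (c m') (d l') z))"
      using l' False by (intro member_le_sum) auto
    also have "\<dots> \<le> ?C"
      by (rule member_le_sum[OF mm]) (auto intro!: sum_nonneg)
    finally show False using lt nn by linarith
  qed
qed

definition miss :: real where
  "miss = mean (\<lambda>x y u z. of_bool (\<not> T x u z))"

definition alarm1 :: real where
  "alarm1 = (\<Sum>x'\<in>X. p x' * mean (\<lambda>x y u z. of_bool (T x' u z)))"

definition alarm2 :: real where
  "alarm2 = (\<Sum>x'\<in>X. p x' * (\<Sum>u'\<in>U. pu u' * mean (\<lambda>x y u z. of_bool (T x' u' z))))"

lemma joint_nonneg: "0 \<le> joint x y u z"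
  using nonneg by (simp add: joint_def)

lemma mean_nonneg: "(\<And>x y u z. 0 \<le> \<phi> x y u z) \<Longrightarrow> 0 \<le> mean \<phi>"
  unfolding mean_def using joint_nonneg by (intro sum_nonneg mult_nonneg_nonneg) auto

lemma alarm_nonneg: "0 \<le> alarm1" "0 \<le> alarm2"
  unfolding alarm1_def alarm2_def using nonneg
  by (auto intro!: sum_nonneg mult_nonneg_nonneg mean_nonneg)

text \<open>With \<open>m\<close> and \<open>l\<close> fixed, the weight \<open>tilted\<close>
  depends on \<open>c m\<close> and \<open>d l\<close> alone. Every other word keeps its codebook
  law, so each term of the union bound is a mean over at most two entries of each codebook.\<close>

lemma decoding_bound:
  fixes M L :: nat
  assumes m: "m \<in> {1..M}" and l: "l \<in> {1..L}"
  shows "iid_mean {1..M} X p (\<lambda>c. iid_mean {1..L} U pu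
      (\<lambda>d. tilted (c m) (d l) (\<lambda>z. of_bool (dec M L c d z \<noteq> m))))
    \<le> miss + M * alarm1 + real M * real L * alarm2"
proof -
  note Ec = iid_mean_single[OF finite_atLeastAtMost fin(1) sum1(1)]
    and Ecc = iid_mean_pair[OF finite_atLeastAtMost fin(1) sum1(1)]
    and Ed = iid_mean_single[OF finite_atLeastAtMost fin(3) sum1(5)]
    and Edd = iid_mean_pair[OF finite_atLeastAtMost fin(3) sum1(5)]
  let ?E = "\<lambda>F. iid_mean {1..M} X p (\<lambda>c. iid_mean {1..L} U pu (F c))"
  let ?A = "\<lambda>c d. tilted (c m) (d l) (\<lambda>z. of_bool (\<not> T (c m) (d l) z))"
  let ?B = "\<lambda>m' c d. tilted (c m) (d l) (\<lambda>z. of_bool (T (c m') (d l) z))"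
  let ?C = "\<lambda>m' l' c d. tilted (c m) (d l) (\<lambda>z. of_bool (T (c m') (d l') z))"
  have "?E (\<lambda>c d. tilted (c m) (d l) (\<lambda>z. of_bool (dec M L c d z \<noteq> m)))
      \<le> ?E (\<lambda>c d. ?A c d + (\<Sum>m'\<in>{1..M} - {m}. ?B m' c d)
          + (\<Sum>m'\<in>{1..M} - {m}. \<Sum>l'\<in>{1..L} - {l}. ?C m' l' c d))"
    unfolding tilted_add[symmetric] tilted_sum[symmetric]
    by (intro iid_mean_mono nonneg tilted_mono dec_error_le m l)
  also have "\<dots> = ?E ?A + (\<Sum>m'\<in>{1..M} - {m}. ?E (?B m'))
      + (\<Sum>m'\<in>{1..M} - {m}. \<Sum>l'\<in>{1..L} - {l}. ?E (?C m' l'))"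
    by (simp only: iid_mean_add iid_mean_sum)
  also have "?E ?A = miss"
  proof -
    have "?E ?A = iid_mean {1..M} X p (\<lambda>c. \<Sum>u\<in>U. pu u * tilted (c m) u (\<lambda>z. of_bool (\<not> T (c m) u z)))"
      using Ed[OF l, of "\<lambda>u. tilted (c m) u (\<lambda>z. of_bool (\<not> T (c m) u z))" for c] by simp
    also have "\<dots> = (\<Sum>x\<in>X. p x * (\<Sum>u\<in>U. pu u * tilted x u (\<lambda>z. of_bool (\<not> T x u z))))"
      by (rule Ec[OF m])
    finally show ?thesis
      unfolding mean_tilted[of "\<lambda>x u z. of_bool (\<not> T x u z)"] miss_def .
  qed
  also have "(\<Sum>m'\<in>{1..M} - {m}. ?E (?B m')) = (\<Sum>m'\<in>{1..M} - {m}. alarm1)"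
  proof (rule sum.cong[OF refl])
    fix m' assume m': "m' \<in> {1..M} - {m}"
    have "?E (?B m') = iid_mean {1..M} X p (\<lambda>c. \<Sum>u\<in>U. pu u * tilted (c m) u (\<lambda>z. of_bool (T (c m') u z)))"
      using Ed[OF l, of "\<lambda>u. tilted (c m) u (\<lambda>z. of_bool (T (c m') u z))" for c] by simp
    also have "\<dots> = (\<Sum>x\<in>X. \<Sum>x'\<in>X. p x * p x' * (\<Sum>u\<in>U. pu u * tilted x u (\<lambda>z. of_bool (T x' u z))))"
      by (rule Ecc) (use m m' in auto)
    also have "\<dots> = (\<Sum>x'\<in>X. p x' * (\<Sum>x\<in>X. p x * (\<Sum>u\<in>U. pu u * tilted x u (\<lambda>z. of_bool (T x' u z)))))"
      by (subst sum.swap) (simp add: sum_distrib_left mult_ac)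
    finally show "?E (?B m') = alarm1"
      unfolding mean_tilted[of "\<lambda>x u z. of_bool (T _ u z)"] alarm1_def .
  qed
  also have "(\<Sum>m'\<in>{1..M} - {m}. \<Sum>l'\<in>{1..L} - {l}. ?E (?C m' l'))
      = (\<Sum>m'\<in>{1..M} - {m}. \<Sum>l'\<in>{1..L} - {l}. alarm2)"
  proof (intro sum.cong refl)
    fix m' l' assume m': "m' \<in> {1..M} - {m}" and l': "l' \<in> {1..L} - {l}"
    have "iid_mean {1..L} U pu (?C m' l' c)
        = (\<Sum>u\<in>U. \<Sum>u'\<in>U. pu u * pu u' * tilted (c m) u (\<lambda>z. of_bool (T (c m') u' z)))" for c
      by (rule Edd) (use l l' in auto)
    then have "?E (?C m' l') = iid_mean {1..M} X p (\<lambda>c. \<Sum>u\<in>U. \<Sum>u'\<in>U. pu u * pu u' * tilted (c m) u (\<lambda>z. of_bool (T (c m') u' z)))"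
      by simp
    also have "\<dots> = (\<Sum>x\<in>X. \<Sum>x'\<in>X. p x * p x' * (\<Sum>u\<in>U. \<Sum>u'\<in>U. pu u * pu u' * tilted x u (\<lambda>z. of_bool (T x' u' z))))"
      by (rule Ecc) (use m m' in auto)
    \<comment> \<open>The fresh pair moves outside, which leaves inside the sum over the true pair
      that \<open>mean_tilted\<close> evaluates.\<close>
    also have "\<dots> = (\<Sum>x'\<in>X. p x' * (\<Sum>u'\<in>U. pu u' * (\<Sum>x\<in>X. p x * (\<Sum>u\<in>U. pu u * tilted x u (\<lambda>z. of_bool (T x' u' z))))))"
      unfolding sum_distrib_left
      by (subst sum.swap, rule sum.cong[OF refl], subst (2) sum.swap, subst sum.swap) (simp add: mult_ac)
    finally show "?E (?C m' l') = alarm2"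
      unfolding mean_tilted[of "\<lambda>x u z. of_bool (T _ _ z)"] alarm2_def .
  qed
  also have "miss + (\<Sum>m'\<in>{1..M} - {m}. alarm1) + (\<Sum>m'\<in>{1..M} - {m}. \<Sum>l'\<in>{1..L} - {l}. alarm2)
      \<le> miss + M * alarm1 + real M * real L * alarm2"
    using alarm_nonneg m l by (intro add_mono) (auto simp: mult.assoc intro!: mult_mono mult_right_mono)
  finally show ?thesis .
qed

text \<open>The order of choices matters: the codebooks are fixed by averaging a bound that mentions
  no relay rule, and only then does the relay take, for each output, the best index for these
  codebooks and their decoder.\<close>

theorem one_shot_code:
  fixes M L :: nat
  assumes M: "0 < M" and L: "0 < L" and a: "0 < a"
  shows "\<exists>(c :: nat \<Rightarrow> 'x) (g :: 'y \<Rightarrow> 'u) (\<delta> :: 'z \<Rightarrow> nat).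
    1 / M * (\<Sum>m\<in>{1..M}. \<Sum>y\<in>Y. \<Sum>z\<in>Z. W (c m) y * V (c m) (g y) y z * of_bool (\<delta> z \<noteq> m))
    \<le> miss + M * alarm1 + real M * real L * alarm2
      + (sqrt (a / L) + 2 * mean (\<lambda>x y u z. of_bool (lr y u > a)))"
proof -
  define e where "e c d m z = (of_bool (dec M L c d z \<noteq> m) :: real)" for c d m z
  \<comment> \<open>A substitute for \<open>M\<close> times the error probability: the decoding
    errors under the idealized weights, plus the price of these weights not summing to 1.\<close>
  define F where "F c d = (\<Sum>m\<in>{1..M}. (\<Sum>l\<in>{1..L}. 1 / L * tilted (c m) (d l) (e c d m))
      + (\<Sum>y\<in>Y. W (c m) y * \<bar>1 - (\<Sum>l\<in>{1..L}. lr y (d l)) / L\<bar>))" for c d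
  define R where "R = miss + M * alarm1 + real M * real L * alarm2
      + (sqrt (a / L) + 2 * mean (\<lambda>x y u z. of_bool (lr y u > a)))"
  have "iid_mean {1..M} X p (\<lambda>c. iid_mean {1..L} U pu (F c))
    = (\<Sum>m\<in>{1..M}. (\<Sum>l\<in>{1..L}. 1 / L * iid_mean {1..M} X p (\<lambda>c. iid_mean {1..L} U pu
         (\<lambda>d. tilted (c m) (d l) (e c d m))))
      + iid_mean {1..M} X p (\<lambda>c. iid_mean {1..L} U pu
         (\<lambda>d. \<Sum>y\<in>Y. W (c m) y * \<bar>1 - (\<Sum>l\<in>{1..L}. lr y (d l)) / L\<bar>)))"
    unfolding F_def by (simp only: iid_mean_add iid_mean_sum iid_mean_cmult)
  also have "\<dots> \<le> (\<Sum>m\<in>{1..M}. (\<Sum>l\<in>{1..L}. 1 / L * (miss + M * alarm1 + real M * real L * alarm2))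
      + (sqrt (a / L) + 2 * mean (\<lambda>x y u z. of_bool (lr y u > a))))"
    unfolding e_def using a L
    by (intro sum_mono add_mono[OF sum_mono[OF mult_left_mono[OF decoding_bound]] covering_bound]) auto
  also have "\<dots> = M * R"
    using L by (simp add: R_def)
  finally have "iid_mean {1..M} X p (\<lambda>c. iid_mean {1..L} U pu (F c)) \<le> M * R" .
  then obtain c d where F: "F c d \<le> M * R"
    using iid_mean_le_imp_ex[OF finite_atLeastAtMost fin(1) sum1(1) nonneg(1)]
      iid_mean_le_imp_ex[OF finite_atLeastAtMost fin(3) sum1(5) nonneg(5)] by metis
  \<comment> \<open>The probability, summed over messages, that \<open>y\<close> occurs and relay
    word \<open>l\<close> then leads to an error. The relay knows \<open>y\<close> but not
    \<open>m\<close>, hence the sum.\<close>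
  define \<psi> where "\<psi> y l = (\<Sum>m\<in>{1..M}. W (c m) y * (\<Sum>z\<in>Z. V (c m) (d l) y z * e c d m z))" for y l
  have "\<exists>l. l \<in> {1..L} \<and> (\<forall>l'\<in>{1..L}. \<psi> y l \<le> \<psi> y l')" for y
    using ex_min_if_finite[of "\<psi> y ` {1..L}"] L by (auto simp: not_less)
  then obtain r where r: "\<And>y. r y \<in> {1..L}" "\<And>y l'. l' \<in> {1..L} \<Longrightarrow> \<psi> y (r y) \<le> \<psi> y l'"
    by metis
  have \<psi>0: "0 \<le> \<psi> y l" for y l
    unfolding \<psi>_def e_def using nonneg by (intro sum_nonneg mult_nonneg_nonneg) auto
  \<comment> \<open>This bound plays the part of \<open>b\<close> in
    \<open>lower_bound_le_weighted_mean\<close>; it reproduces exactly the weights of the covering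
    term in \<open>F\<close>.\<close>
  have \<psi>1: "\<psi> y l \<le> (\<Sum>m\<in>{1..M}. W (c m) y)" for y l
  proof -
    have "\<psi> y l \<le> (\<Sum>m\<in>{1..M}. W (c m) y * (\<Sum>z\<in>Z. V (c m) (d l) y z * 1))"
      unfolding \<psi>_def e_def using nonneg by (intro sum_mono mult_left_mono) auto
    then show ?thesis by (simp add: sum1)
  qed
  have "(\<Sum>m\<in>{1..M}. \<Sum>y\<in>Y. \<Sum>z\<in>Z. W (c m) y * V (c m) (d (r y)) y z * e c d m z)
      = (\<Sum>y\<in>Y. \<psi> y (r y))"
    unfolding \<psi>_def by (subst sum.swap) (simp add: sum_distrib_left mult_ac)
  also have "\<dots> \<le> (\<Sum>y\<in>Y. (\<Sum>l\<in>{1..L}. 1 / L * (lr y (d l) * \<psi> y l))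
      + (\<Sum>m\<in>{1..M}. W (c m) y) * \<bar>1 - (\<Sum>l\<in>{1..L}. lr y (d l)) / L\<bar>)"
    by (intro sum_mono lower_bound_le_weighted_mean lr_nonneg r \<psi>0 \<psi>1 L)
  also have "\<dots> = F c d"
  proof -
    have "(\<Sum>y\<in>Y. \<Sum>l\<in>{1..L}. 1 / L * (lr y (d l) * \<psi> y l))
        = (\<Sum>m\<in>{1..M}. \<Sum>l\<in>{1..L}. 1 / L * tilted (c m) (d l) (e c d m))"
    proof -
      have "(\<Sum>y\<in>Y. \<Sum>l\<in>{1..L}. 1 / L * (lr y (d l) * \<psi> y l))
        = (\<Sum>l\<in>{1..L}. \<Sum>y\<in>Y. \<Sum>m\<in>{1..M}. 1 / L * (lr y (d l) * (W (c m) y * (\<Sum>z\<in>Z. V (c m) (d l) y z * e c d m z))))"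
        unfolding \<psi>_def by (subst sum.swap) (simp only: sum_distrib_left[of _ _ "{1..M}"])
      also have "\<dots> = (\<Sum>l\<in>{1..L}. \<Sum>m\<in>{1..M}. \<Sum>y\<in>Y. 1 / L * (lr y (d l) * (W (c m) y * (\<Sum>z\<in>Z. V (c m) (d l) y z * e c d m z))))"
        by (intro sum.cong refl sum.swap)
      also have "\<dots> = (\<Sum>m\<in>{1..M}. \<Sum>l\<in>{1..L}. \<Sum>y\<in>Y. 1 / L * (lr y (d l) * (W (c m) y * (\<Sum>z\<in>Z. V (c m) (d l) y z * e c d m z))))"
        by (rule sum.swap)
      finally show ?thesis
        unfolding tilted_def by (simp only: sum_distrib_left[of _ _ Y])
    qed
    moreover have "(\<Sum>y\<in>Y. (\<Sum>m\<in>{1..M}. W (c m) y) * \<bar>1 - (\<Sum>l\<in>{1..L}. lr y (d l)) / L\<bar>)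
        = (\<Sum>m\<in>{1..M}. \<Sum>y\<in>Y. W (c m) y * \<bar>1 - (\<Sum>l\<in>{1..L}. lr y (d l)) / L\<bar>)"
      unfolding sum_distrib_right by (rule sum.swap)
    ultimately show ?thesis
      by (simp add: F_def sum.distrib)
  qed
  finally have "(\<Sum>m\<in>{1..M}. \<Sum>y\<in>Y. \<Sum>z\<in>Z. W (c m) y * V (c m) (d (r y)) y z * e c d m z) \<le> M * R"
    using F by linarith
  then have "1 / M * (\<Sum>m\<in>{1..M}. \<Sum>y\<in>Y. \<Sum>z\<in>Z. W (c m) y * V (c m) (d (r y)) y z * e c d m z) \<le> R"
    using M by (simp add: field_simps)
  then show ?thesis
    unfolding R_def e_def
    by (intro exI[of _ c] exI[of _ "\<lambda>y. d (r y)"] exI[of _ "dec M L c d"])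
qed

end

subsection \<open>Memoryless extension\<close>

text \<open>Extensional functions in place of lists, so that sums of products factor by
  \<open>prod_sum_PiE\<close>. The lists of \<open>relay_error\<close> are translated by
  \<open>sum_lists_eq_sum_seqs\<close>.\<close>

abbreviation seqs :: "nat \<Rightarrow> (nat \<Rightarrow> 'a) set" where
  "seqs n \<equiv> PiE {..<n} (\<lambda>_. UNIV)"

lemma finite_seqs: "finite (seqs n :: (nat \<Rightarrow> 'a::finite) set)"
  by (intro finite_PiE) auto

lemma sum_seqs_prod:
  fixes F :: "nat \<Rightarrow> 'a::finite \<Rightarrow> real"
  shows "(\<Sum>x\<in>seqs n. \<Prod>i<n. F i (x i)) = (\<Prod>i<n. \<Sum>a\<in>UNIV. F i a)"
  by (subst prod_sum_PiE) auto

lemma sum_seqs_prod4: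
  fixes F :: "'x::finite \<Rightarrow> 'y::finite \<Rightarrow> 'u::finite \<Rightarrow> 'z::finite \<Rightarrow> real"
  shows "(\<Sum>x\<in>seqs n. \<Sum>y\<in>seqs n. \<Sum>u\<in>seqs n. \<Sum>z\<in>seqs n. \<Prod>i<n. F (x i) (y i) (u i) (z i))
    = (\<Sum>a\<in>UNIV. \<Sum>b\<in>UNIV. \<Sum>c\<in>UNIV. \<Sum>d\<in>UNIV. F a b c d) ^ n"
proof -
  have "(\<Sum>x\<in>seqs n. \<Sum>y\<in>seqs n. \<Sum>u\<in>seqs n. \<Sum>z\<in>seqs n. \<Prod>i<n. F (x i) (y i) (u i) (z i))
      = (\<Sum>x\<in>seqs n. \<Sum>y\<in>seqs n. \<Sum>u\<in>seqs n. \<Prod>i<n. \<Sum>d\<in>UNIV. F (x i) (y i) (u i) d)"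
    by (intro sum.cong refl sum_seqs_prod[where F = "\<lambda>i d. F (_ i) (_ i) (_ i) d"])
  also have "\<dots> = (\<Sum>x\<in>seqs n. \<Sum>y\<in>seqs n. \<Prod>i<n. \<Sum>c\<in>UNIV. \<Sum>d\<in>UNIV. F (x i) (y i) c d)"
    by (intro sum.cong refl sum_seqs_prod[where F = "\<lambda>i c. \<Sum>d\<in>UNIV. F (_ i) (_ i) c d"])
  also have "\<dots> = (\<Sum>x\<in>seqs n. \<Prod>i<n. \<Sum>b\<in>UNIV. \<Sum>c\<in>UNIV. \<Sum>d\<in>UNIV. F (x i) b c d)"
    by (intro sum.cong refl sum_seqs_prod[where F = "\<lambda>i b. \<Sum>c\<in>UNIV. \<Sum>d\<in>UNIV. F (_ i) b c d"])
  also have "\<dots> = (\<Prod>i<n. \<Sum>a\<in>UNIV. \<Sum>b\<in>UNIV. \<Sum>c\<in>UNIV. \<Sum>d\<in>UNIV. F a b c d)"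
    by (rule sum_seqs_prod)
  finally show ?thesis by simp
qed

lemma sum_swap4:
  fixes G :: "'x \<Rightarrow> 'y \<Rightarrow> 'u \<Rightarrow> 'z \<Rightarrow> real"
  shows "(\<Sum>x\<in>X. \<Sum>y\<in>Y. \<Sum>u\<in>U. \<Sum>z\<in>Z. G x y u z) = (\<Sum>u\<in>U. \<Sum>z\<in>Z. \<Sum>x\<in>X. \<Sum>y\<in>Y. G x y u z)"
proof -
  have "(\<Sum>x\<in>X. \<Sum>y\<in>Y. \<Sum>u\<in>U. \<Sum>z\<in>Z. G x y u z) = (\<Sum>x\<in>X. \<Sum>u\<in>U. \<Sum>y\<in>Y. \<Sum>z\<in>Z. G x y u z)"
    by (intro sum.cong refl sum.swap)
  also have "\<dots> = (\<Sum>u\<in>U. \<Sum>x\<in>X. \<Sum>y\<in>Y. \<Sum>z\<in>Z. G x y u z)"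
    by (rule sum.swap)
  also have "\<dots> = (\<Sum>u\<in>U. \<Sum>x\<in>X. \<Sum>z\<in>Z. \<Sum>y\<in>Y. G x y u z)"
    by (intro sum.cong refl sum.swap)
  also have "\<dots> = (\<Sum>u\<in>U. \<Sum>z\<in>Z. \<Sum>x\<in>X. \<Sum>y\<in>Y. G x y u z)"
    by (intro sum.cong refl sum.swap)
  finally show ?thesis .
qed

lemma sum4_mono:
  fixes F G :: "'x \<Rightarrow> 'y \<Rightarrow> 'u \<Rightarrow> 'z \<Rightarrow> real"
  assumes "\<And>x y u z. F x y u z \<le> G x y u z"
  shows "(\<Sum>x\<in>X. \<Sum>y\<in>Y. \<Sum>u\<in>U. \<Sum>z\<in>Z. F x y u z) \<le> (\<Sum>x\<in>X. \<Sum>y\<in>Y. \<Sum>u\<in>U. \<Sum>z\<in>Z. G x y u z)"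
  by (intro sum_mono assms)

text \<open>The moment generating function \<open>\<phi>\<close> of \<open>g - \<mu>\<close> is 1 at
  0 with negative derivative there, so \<open>\<phi> t < 1\<close> for some positive
  \<open>t\<close>. Exponential Markov and the product structure then allow
  \<open>\<rho> = \<phi> t\<close>.\<close>

lemma chernoff_bound:
  fixes J g :: "'x::finite \<Rightarrow> 'y::finite \<Rightarrow> 'u::finite \<Rightarrow> 'z::finite \<Rightarrow> real"
  assumes J: "\<And>x y u z. 0 \<le> J x y u z" "(\<Sum>x\<in>UNIV. \<Sum>y\<in>UNIV. \<Sum>u\<in>UNIV. \<Sum>z\<in>UNIV. J x y u z) = 1"
    and \<mu>: "(\<Sum>x\<in>UNIV. \<Sum>y\<in>UNIV. \<Sum>u\<in>UNIV. \<Sum>z\<in>UNIV. J x y u z * g x y u z) < \<mu>"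
  shows "\<exists>\<rho>\<ge>0. \<rho> < 1 \<and> (\<forall>n. (\<Sum>x\<in>seqs n. \<Sum>y\<in>seqs n. \<Sum>u\<in>seqs n. \<Sum>z\<in>seqs n.
      (\<Prod>i<n. J (x i) (y i) (u i) (z i)) * of_bool (n * \<mu> \<le> (\<Sum>i<n. g (x i) (y i) (u i) (z i)))) \<le> \<rho> ^ n)"
proof -
  define \<phi> where "\<phi> t = (\<Sum>x\<in>UNIV. \<Sum>y\<in>UNIV. \<Sum>u\<in>UNIV. \<Sum>z\<in>UNIV. J x y u z * exp (t * (g x y u z - \<mu>)))" for t
  have "(\<phi> has_real_derivative
      (\<Sum>x\<in>UNIV. \<Sum>y\<in>UNIV. \<Sum>u\<in>UNIV. \<Sum>z\<in>UNIV. J x y u z * (g x y u z - \<mu>))) (at 0)"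
    unfolding \<phi>_def by (auto intro!: derivative_eq_intros sum.cong)
  moreover have "(\<Sum>x\<in>UNIV. \<Sum>y\<in>UNIV. \<Sum>u\<in>UNIV. \<Sum>z\<in>UNIV. J x y u z * (g x y u z - \<mu>)) < 0"
    using \<mu> J(2) by (simp add: right_diff_distrib sum_subtractf flip: sum_distrib_right)
  ultimately obtain d where d: "d > 0" "\<And>h. 0 < h \<Longrightarrow> h < d \<Longrightarrow> \<phi> (0 + h) < \<phi> 0"
    using DERIV_neg_dec_right by blast
  define t where "t = d / 2"
  have t: "0 < t" "\<phi> t < \<phi> 0"
    using d(1) d(2)[of t] by (auto simp: t_def)
  have "\<phi> 0 = 1"
    using J(2) by (simp add: \<phi>_def)
  moreover have "0 \<le> \<phi> t"
    unfolding \<phi>_def using J(1) by (auto intro!: sum_nonneg)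
  moreover have "(\<Sum>x\<in>seqs n. \<Sum>y\<in>seqs n. \<Sum>u\<in>seqs n. \<Sum>z\<in>seqs n.
      (\<Prod>i<n. J (x i) (y i) (u i) (z i)) * of_bool (n * \<mu> \<le> (\<Sum>i<n. g (x i) (y i) (u i) (z i)))) \<le> \<phi> t ^ n" for n
  proof -
    have "(\<Prod>i<n. J (x i) (y i) (u i) (z i)) * of_bool (n * \<mu> \<le> (\<Sum>i<n. g (x i) (y i) (u i) (z i)))
        \<le> (\<Prod>i<n. J (x i) (y i) (u i) (z i) * exp (t * (g (x i) (y i) (u i) (z i) - \<mu>)))" for x y u z
    proof -
      have "of_bool (n * \<mu> \<le> (\<Sum>i<n. g (x i) (y i) (u i) (z i)))
          \<le> exp (t * ((\<Sum>i<n. g (x i) (y i) (u i) (z i)) - n * \<mu>))"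
        using t(1) by auto
      also have "\<dots> = (\<Prod>i<n. exp (t * (g (x i) (y i) (u i) (z i) - \<mu>)))"
        by (simp add: sum_subtractf flip: exp_sum sum_distrib_left)
      finally show ?thesis
        unfolding prod.distrib using J(1) by (intro mult_left_mono prod_nonneg) auto
    qed
    then have "(\<Sum>x\<in>seqs n. \<Sum>y\<in>seqs n. \<Sum>u\<in>seqs n. \<Sum>z\<in>seqs n.
      (\<Prod>i<n. J (x i) (y i) (u i) (z i)) * of_bool (n * \<mu> \<le> (\<Sum>i<n. g (x i) (y i) (u i) (z i))))
      \<le> (\<Sum>x\<in>seqs n. \<Sum>y\<in>seqs n. \<Sum>u\<in>seqs n. \<Sum>z\<in>seqs n.
      (\<Prod>i<n. J (x i) (y i) (u i) (z i) * exp (t * (g (x i) (y i) (u i) (z i) - \<mu>))))"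
      by (rule sum4_mono)
    also have "\<dots> = \<phi> t ^ n"
      unfolding \<phi>_def by (rule sum_seqs_prod4)
    finally show ?thesis .
  qed
  ultimately show ?thesis
    using t(2) by auto
qed

text \<open>Change of measure on an event: a passed density test lets the true law \<open>B\<close>
  dominate the reference law \<open>A\<close> with an exponential discount.\<close>

lemma mult_of_bool_le:
  fixes t A B :: real
  assumes "P \<Longrightarrow> 2 powr t * A \<le> B" "0 \<le> B"
  shows "A * of_bool P \<le> 2 powr (- t) * B"
proof (cases P)
  case True
  then show ?thesis
    using assms(1) by (simp add: powr_minus field_simps)
qed (use assms in simp)

lemma num_messages_ge: "2 powr (real n * R) \<le> real (num_messages R n)"
  unfolding num_messages_def by linarith

lemma num_messages_pos: "0 < num_messages R n"
  using num_messages_ge[of n R] by (metis of_nat_0_less_iff order_less_le_trans powr_gt_zero zero_neq_numeral)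

lemma num_messages_le:
  assumes "0 \<le> R"
  shows "real (num_messages R n) \<le> 2 * 2 powr (real n * R)"
proof -
  have "1 \<le> 2 powr (real n * R)"
    using assms by (simp add: ge_one_powr_ge_zero)
  then show ?thesis
    unfolding num_messages_def by linarith
qed

section \<open>The single-letter law, its marginals and its information quantities\<close>

locale memoryless_relay =
  fixes p :: "'x::finite \<Rightarrow> real" and W :: "'x \<Rightarrow> 'y::finite \<Rightarrow> real" and q :: "'y \<Rightarrow> 'u::finite \<Rightarrow> real"
    and V :: "'x \<Rightarrow> 'u \<Rightarrow> 'y \<Rightarrow> 'z::finite \<Rightarrow> real"
  assumes nonneg: "\<And>x. 0 \<le> p x" "\<And>x y. 0 \<le> W x y" "\<And>y u. 0 \<le> q y u" "\<And>x u y z. 0 \<le> V x u y z"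
    and sum1: "(\<Sum>x\<in>UNIV. p x) = 1" "\<And>x. (\<Sum>y\<in>UNIV. W x y) = 1" "\<And>y. (\<Sum>u\<in>UNIV. q y u) = 1"
      "\<And>x u y. (\<Sum>z\<in>UNIV. V x u y z) = 1"
begin

definition J :: "'x \<Rightarrow> 'y \<Rightarrow> 'u \<Rightarrow> 'z \<Rightarrow> real" where
  "J x y u z = p x * W x y * q y u * V x u y z"

definition Jxuz :: "'x \<Rightarrow> 'u \<Rightarrow> 'z \<Rightarrow> real" where
  "Jxuz x u z = (\<Sum>y\<in>UNIV. J x y u z)"

definition Juz :: "'u \<Rightarrow> 'z \<Rightarrow> real" where
  "Juz u z = (\<Sum>x\<in>UNIV. \<Sum>y\<in>UNIV. J x y u z)"

definition Ju :: "'u \<Rightarrow> real" where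
  "Ju u = (\<Sum>x\<in>UNIV. \<Sum>y\<in>UNIV. \<Sum>z\<in>UNIV. J x y u z)"

definition Jz :: "'z \<Rightarrow> real" where
  "Jz z = (\<Sum>x\<in>UNIV. \<Sum>y\<in>UNIV. \<Sum>u\<in>UNIV. J x y u z)"

definition EJ :: "('x \<Rightarrow> 'y \<Rightarrow> 'u \<Rightarrow> 'z \<Rightarrow> real) \<Rightarrow> real" where
  "EJ g = (\<Sum>x\<in>UNIV. \<Sum>y\<in>UNIV. \<Sum>u\<in>UNIV. \<Sum>z\<in>UNIV. J x y u z * g x y u z)"

definition I_direct :: real where
  "I_direct = EJ (\<lambda>x y u z. log 2 (Jxuz x u z / (p x * Juz u z)))"

text \<open>The divergence of p(x,u,z) from the product of its three marginals, that is I(X1,U;Y3) +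
  I(X1;U).\<close>

definition I_joint :: real where
  "I_joint = EJ (\<lambda>x y u z. log 2 (Jxuz x u z / (p x * Ju u * Jz z)))"

text \<open>This is I(U;Y2), the mean log-likelihood ratio governing the covering.\<close>

definition I_cover :: real where
  "I_cover = EJ (\<lambda>x y u z. log 2 (q y u / Ju u))"

lemma J_nonneg: "0 \<le> J x y u z"
  using nonneg by (simp add: J_def)

lemma marginals_nonneg: "0 \<le> Jxuz x u z" "0 \<le> Juz u z" "0 \<le> Ju u" "0 \<le> Jz z"
  by (auto simp: Jxuz_def Juz_def Ju_def Jz_def intro!: sum_nonneg J_nonneg)

lemma sum_J: "(\<Sum>x\<in>UNIV. \<Sum>y\<in>UNIV. \<Sum>u\<in>UNIV. \<Sum>z\<in>UNIV. J x y u z) = 1"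
  by (simp add: J_def sum1 flip: sum_distrib_left)

lemma Ju_eq: "Ju u = (\<Sum>x\<in>UNIV. \<Sum>y\<in>UNIV. p x * W x y * q y u)"
  by (simp add: Ju_def J_def sum1 flip: sum_distrib_left)

lemma sum_Ju: "(\<Sum>u\<in>UNIV. Ju u) = 1"
proof -
  have "(\<Sum>u\<in>UNIV. Ju u) = (\<Sum>x\<in>UNIV. \<Sum>y\<in>UNIV. \<Sum>u\<in>UNIV. p x * W x y * q y u)"
    unfolding Ju_eq by (rule trans[OF sum.swap sum.cong[OF refl sum.swap]])
  then show ?thesis
    by (simp add: sum1 flip: sum_distrib_left)
qed

lemma Ju_pos:
  assumes "p x * W x y * q y u \<noteq> 0"
  shows "0 < Ju u"
proof -
  have "0 < p x * W x y * q y u"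
    using assms nonneg by (simp add: less_le)
  also have "\<dots> \<le> (\<Sum>y\<in>UNIV. p x * W x y * q y u)"
    using nonneg by (intro member_le_sum[of y]) auto
  also have "\<dots> \<le> Ju u"
    unfolding Ju_eq using nonneg
    by (intro member_le_sum[of x UNIV "\<lambda>x. \<Sum>y\<in>UNIV. p x * W x y * q y u"]) (auto intro!: sum_nonneg)
  finally show ?thesis .
qed

lemma marginals_pos:
  assumes "J x y u z \<noteq> 0"
  shows "0 < p x" "0 < q y u" "0 < Jxuz x u z" "0 < Juz u z" "0 < Ju u" "0 < Jz z"
proof -
  have J: "0 < J x y u z"
    using assms J_nonneg[of x y u z] by linarith
  show "0 < p x" "0 < q y u"
    using assms nonneg(1)[of x] nonneg(3)[of y u] by (auto simp: J_def less_le)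
  show "0 < Ju u"
    using assms by (intro Ju_pos[of x y]) (auto simp: J_def)
  show 1: "0 < Jxuz x u z"
    unfolding Jxuz_def using J by (intro sum_pos2[of _ y]) (auto simp: J_nonneg)
  show "0 < Juz u z"
    unfolding Juz_def using 1 by (intro sum_pos2[of _ x]) (auto simp: J_nonneg Jxuz_def intro!: sum_nonneg)
  show "0 < Jz z"
    unfolding Jz_def using J
    by (intro sum_pos2[of _ x] sum_pos2[of _ y] sum_pos2[of _ u]) (auto simp: J_nonneg intro!: sum_nonneg)
qed

text \<open>Gibbs' inequality from ln t <= t - 1: the pointwise minorant is a multiple of a
  difference of two probability laws and sums to 0. It ensures a nonnegative rate for the relay
  codebook, as \<open>num_messages_le\<close> requires.\<close>

lemma I_cover_nonneg: "0 \<le> I_cover"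
proof -
  have "0 = (\<Sum>x\<in>UNIV. \<Sum>y\<in>UNIV. \<Sum>u\<in>UNIV. \<Sum>z\<in>UNIV. (J x y u z - p x * W x y * Ju u * V x u y z) / ln 2)"
    using sum_J by (simp add: sum_subtractf sum1 sum_Ju flip: sum_distrib_left sum_divide_distrib)
  also have "\<dots> \<le> I_cover"
    unfolding I_cover_def EJ_def
  proof (rule sum4_mono)
    fix x y u z
    show "(J x y u z - p x * W x y * Ju u * V x u y z) / ln 2 \<le> J x y u z * log 2 (q y u / Ju u)"
    proof (cases "J x y u z = 0")
      case True
      then show ?thesis
        using nonneg marginals_nonneg by (simp add: divide_nonpos_pos)
    next
      case False
      note pos = marginals_pos[OF False]
      have "ln (Ju u / q y u) \<le> Ju u / q y u - 1"
        using pos by (intro ln_le_minus_one) auto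
      then have "1 - Ju u / q y u \<le> ln (q y u / Ju u)"
        using pos by (simp add: ln_div)
      then have "J x y u z * (1 - Ju u / q y u) / ln 2 \<le> J x y u z * ln (q y u / Ju u) / ln 2"
        using J_nonneg by (intro divide_right_mono mult_left_mono) auto
      moreover have "J x y u z * (1 - Ju u / q y u) = J x y u z - p x * W x y * Ju u * V x u y z"
        using pos by (simp add: J_def field_simps)
      ultimately show ?thesis
        by (simp add: log_def)
    qed
  qed
  finally show ?thesis .
qed

text \<open>Two lower bounds on information densities, multiplied out so that vanishing
  probabilities need no quotient or logarithm. The relay's observation is absent because the decoder
  does not see it.\<close>

definition typical :: "real \<Rightarrow> nat \<Rightarrow> (nat \<Rightarrow> 'x) \<Rightarrow> (nat \<Rightarrow> 'u) \<Rightarrow> (nat \<Rightarrow> 'z) \<Rightarrow> bool" where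
  "typical \<epsilon> n x u z \<longleftrightarrow>
     2 powr (n * (I_direct - \<epsilon>)) * (\<Prod>i<n. p (x i) * Juz (u i) (z i)) \<le> (\<Prod>i<n. Jxuz (x i) (u i) (z i)) \<and>
     2 powr (n * (I_joint - \<epsilon>)) * (\<Prod>i<n. p (x i) * Ju (u i) * Jz (z i)) \<le> (\<Prod>i<n. Jxuz (x i) (u i) (z i))"

section \<open>The product laws on sequences as an instance of the one-shot problem\<close>

lemma one_shot_seqs:
  "one_shot_relay (seqs n) (seqs n) (seqs n) (seqs n) (\<lambda>x. \<Prod>i<n. p (x i)) (\<lambda>x y. \<Prod>i<n. W (x i) (y i))
     (\<lambda>y u. \<Prod>i<n. q (y i) (u i)) (\<lambda>x u y z. \<Prod>i<n. V (x i) (u i) (y i) (z i)) (\<lambda>u. \<Prod>i<n. Ju (u i))"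
proof
  show "(\<Sum>x\<in>seqs n. \<Prod>i<n. p (x i)) = 1"
    by (simp add: sum_seqs_prod[where F = "\<lambda>i. p"] sum1)
  show "(\<Sum>y\<in>seqs n. \<Prod>i<n. W (x i) (y i)) = 1" for x
    by (simp add: sum_seqs_prod[where F = "\<lambda>i. W (x i)"] sum1)
  show "(\<Sum>u\<in>seqs n. \<Prod>i<n. q (y i) (u i)) = 1" for y
    by (simp add: sum_seqs_prod[where F = "\<lambda>i. q (y i)"] sum1)
  show "(\<Sum>z\<in>seqs n. \<Prod>i<n. V (x i) (u i) (y i) (z i)) = 1" for x u y
    by (simp add: sum_seqs_prod[where F = "\<lambda>i. V (x i) (u i) (y i)"] sum1)
  show "(\<Sum>u\<in>seqs n. \<Prod>i<n. Ju (u i)) = 1"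
    by (simp add: sum_seqs_prod[where F = "\<lambda>i. Ju"] sum_Ju)
  fix x y u
  assume "(\<Prod>i<n. p (x i)) * (\<Prod>i<n. W (x i) (y i)) * (\<Prod>i<n. q (y i) (u i)) \<noteq> 0"
  then have "p (x i) * W (x i) (y i) * q (y i) (u i) \<noteq> 0" if "i < n" for i
    using that by auto
  from Ju_pos[OF this] show "(\<Prod>i<n. Ju (u i)) \<noteq> 0"
    by force
qed (auto intro!: finite_seqs prod_nonneg nonneg marginals_nonneg)

context
  fixes n :: nat and \<epsilon> :: real
begin

interpretation S: one_shot_relay "seqs n" "seqs n" "seqs n" "seqs n" "\<lambda>x. \<Prod>i<n. p (x i)"
  "\<lambda>x y. \<Prod>i<n. W (x i) (y i)" "\<lambda>y u. \<Prod>i<n. q (y i) (u i)"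
  "\<lambda>x u y z. \<Prod>i<n. V (x i) (u i) (y i) (z i)" "\<lambda>u. \<Prod>i<n. Ju (u i)" "typical \<epsilon> n"
  by (rule one_shot_seqs)

lemma joint_seqs: "S.joint x y u z = (\<Prod>i<n. J (x i) (y i) (u i) (z i))"
  by (simp add: S.joint_def J_def prod.distrib)

lemma lr_seqs: "S.lr y u = (\<Prod>i<n. q (y i) (u i) / Ju (u i))"
  by (simp add: S.lr_def prod_dividef)

lemma mean_seqs_uz: "S.mean (\<lambda>x y u z. \<phi> u z) = (\<Sum>u\<in>seqs n. \<Sum>z\<in>seqs n. (\<Prod>i<n. Juz (u i) (z i)) * \<phi> u z)"
proof -
  have "(\<Sum>x\<in>seqs n. \<Sum>y\<in>seqs n. \<Prod>i<n. J (x i) (y i) (u i) (z i)) = (\<Prod>i<n. Juz (u i) (z i))" for u z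
  proof -
    have "(\<Sum>x\<in>seqs n. \<Sum>y\<in>seqs n. \<Prod>i<n. J (x i) (y i) (u i) (z i))
        = (\<Sum>x\<in>seqs n. \<Prod>i<n. \<Sum>b\<in>UNIV. J (x i) b (u i) (z i))"
      by (intro sum.cong refl sum_seqs_prod[where F = "\<lambda>i b. J (_ i) b (u i) (z i)"])
    also have "\<dots> = (\<Prod>i<n. \<Sum>a\<in>UNIV. \<Sum>b\<in>UNIV. J a b (u i) (z i))"
      by (rule sum_seqs_prod[where F = "\<lambda>i a. \<Sum>b\<in>UNIV. J a b (u i) (z i)"])
    finally show ?thesis by (simp add: Juz_def)
  qed
  then show ?thesis
    unfolding S.mean_def joint_seqs by (subst sum_swap4) (simp flip: sum_distrib_right)
qed

lemma sum_Juz: "(\<Sum>u\<in>UNIV. Juz u z) = Jz z"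
  unfolding Juz_def Jz_def
  by (subst sum.swap) (intro sum.cong refl sum.swap)

lemma mean_seqs_z: "S.mean (\<lambda>x y u z. \<phi> z) = (\<Sum>z\<in>seqs n. (\<Prod>i<n. Jz (z i)) * \<phi> z)"
proof -
  have "(\<Sum>u\<in>seqs n. \<Prod>i<n. Juz (u i) (z i)) = (\<Prod>i<n. Jz (z i))" for z
    by (simp add: sum_seqs_prod[where F = "\<lambda>i u. Juz u (z i)"] sum_Juz)
  then show ?thesis
    unfolding mean_seqs_uz[of "\<lambda>u z. \<phi> z"] by (subst sum.swap) (simp flip: sum_distrib_right)
qed

lemma sum_seqs_Jxuz: "(\<Sum>x\<in>seqs n. \<Sum>u\<in>seqs n. \<Sum>z\<in>seqs n. \<Prod>i<n. Jxuz (x i) (u i) (z i)) = 1"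
proof -
  have "(\<Sum>x\<in>seqs n. \<Sum>u\<in>seqs n. \<Sum>z\<in>seqs n. \<Prod>i<n. Jxuz (x i) (u i) (z i))
      = (\<Sum>x\<in>seqs n. \<Sum>u\<in>seqs n. \<Sum>z\<in>seqs n. \<Sum>y\<in>seqs n. \<Prod>i<n. J (x i) (y i) (u i) (z i))"
    unfolding Jxuz_def
    by (intro sum.cong refl sum_seqs_prod[where F = "\<lambda>i b. J (_ i) b (_ i) (_ i)", symmetric])
  also have "\<dots> = (\<Sum>x\<in>seqs n. \<Sum>y\<in>seqs n. \<Sum>u\<in>seqs n. \<Sum>z\<in>seqs n. \<Prod>i<n. J (x i) (y i) (u i) (z i))"
    by (intro sum.cong refl) (rule trans[OF sum.cong[OF refl sum.swap] sum.swap])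
  finally show ?thesis
    by (simp add: sum_seqs_prod4 sum_J)
qed

text \<open>Where the first test passes, p(x)p(u,z) is at most
  \<open>2 powr (- (n * (I_direct - \<epsilon>)))\<close> times the true law of (x,u,z), which has
  total mass 1. \<open>alarm2_le\<close> uses the second test in the same way.\<close>

lemma alarm1_le: "S.alarm1 \<le> 2 powr (- (n * (I_direct - \<epsilon>)))"
proof -
  let ?b = "2 powr (- (n * (I_direct - \<epsilon>)))"
  have "S.alarm1 = (\<Sum>x\<in>seqs n. \<Sum>u\<in>seqs n. \<Sum>z\<in>seqs n.
      (\<Prod>i<n. p (x i) * Juz (u i) (z i)) * of_bool (typical \<epsilon> n x u z))"
    unfolding S.alarm1_def mean_seqs_uz by (simp add: sum_distrib_left prod.distrib mult_ac)
  also have "\<dots> \<le> (\<Sum>x\<in>seqs n. \<Sum>u\<in>seqs n. \<Sum>z\<in>seqs n. ?b * (\<Prod>i<n. Jxuz (x i) (u i) (z i)))"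
    by (intro sum_mono mult_of_bool_le prod_nonneg marginals_nonneg) (simp only: typical_def)
  also have "\<dots> = ?b"
    using sum_seqs_Jxuz by (simp flip: sum_distrib_left)
  finally show ?thesis .
qed

lemma alarm2_le: "S.alarm2 \<le> 2 powr (- (n * (I_joint - \<epsilon>)))"
proof -
  let ?b = "2 powr (- (n * (I_joint - \<epsilon>)))"
  have "S.alarm2 = (\<Sum>x\<in>seqs n. \<Sum>u\<in>seqs n. \<Sum>z\<in>seqs n.
      (\<Prod>i<n. p (x i) * Ju (u i) * Jz (z i)) * of_bool (typical \<epsilon> n x u z))"
    unfolding S.alarm2_def mean_seqs_z by (simp add: sum_distrib_left prod.distrib mult_ac)
  also have "\<dots> \<le> (\<Sum>x\<in>seqs n. \<Sum>u\<in>seqs n. \<Sum>z\<in>seqs n. ?b * (\<Prod>i<n. Jxuz (x i) (u i) (z i)))"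
    by (intro sum_mono mult_of_bool_le prod_nonneg marginals_nonneg) (simp only: typical_def)
  also have "\<dots> = ?b"
    using sum_seqs_Jxuz by (simp flip: sum_distrib_left)
  finally show ?thesis .
qed

text \<open>All quantities are spelled out because the interpretation \<open>S\<close> ends with
  this context.\<close>

theorem seqs_code:
  fixes M L :: nat and a :: real
  assumes "0 < M" "0 < L" "0 < a"
  shows "\<exists>(c :: nat \<Rightarrow> nat \<Rightarrow> 'x) (g :: (nat \<Rightarrow> 'y) \<Rightarrow> nat \<Rightarrow> 'u) (\<delta> :: (nat \<Rightarrow> 'z) \<Rightarrow> nat).
    1 / M * (\<Sum>m\<in>{1..M}. \<Sum>y\<in>seqs n. \<Sum>z\<in>seqs n. (\<Prod>i<n. W (c m i) (y i)) *
      (\<Prod>i<n. V (c m i) (g y i) (y i) (z i)) * of_bool (\<delta> z \<noteq> m))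
    \<le> (\<Sum>x\<in>seqs n. \<Sum>y\<in>seqs n. \<Sum>u\<in>seqs n. \<Sum>z\<in>seqs n.
          (\<Prod>i<n. J (x i) (y i) (u i) (z i)) * of_bool (\<not> typical \<epsilon> n x u z))
      + M * 2 powr (- (n * (I_direct - \<epsilon>))) + real M * real L * 2 powr (- (n * (I_joint - \<epsilon>)))
      + (sqrt (a / L) + 2 * (\<Sum>x\<in>seqs n. \<Sum>y\<in>seqs n. \<Sum>u\<in>seqs n. \<Sum>z\<in>seqs n.
          (\<Prod>i<n. J (x i) (y i) (u i) (z i)) * of_bool ((\<Prod>i<n. q (y i) (u i) / Ju (u i)) > a)))"
proof -
  have "S.miss + M * S.alarm1 + real M * real L * S.alarm2
      + (sqrt (a / L) + 2 * S.mean (\<lambda>x y u z. of_bool (S.lr y u > a)))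
    \<le> S.miss + M * 2 powr (- (n * (I_direct - \<epsilon>))) + real M * real L * 2 powr (- (n * (I_joint - \<epsilon>)))
      + (sqrt (a / L) + 2 * S.mean (\<lambda>x y u z. of_bool (S.lr y u > a)))"
    by (intro add_mono order_refl mult_left_mono alarm1_le alarm2_le) auto
  moreover obtain c g \<delta> where
    "1 / M * (\<Sum>m\<in>{1..M}. \<Sum>y\<in>seqs n. \<Sum>z\<in>seqs n. (\<Prod>i<n. W (c m i) (y i)) *
      (\<Prod>i<n. V (c m i) (g y i) (y i) (z i)) * of_bool (\<delta> z \<noteq> m))
    \<le> S.miss + M * S.alarm1 + real M * real L * S.alarm2
      + (sqrt (a / L) + 2 * S.mean (\<lambda>x y u z. of_bool (S.lr y u > a)))"
    using S.one_shot_code[OF assms] by blast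
  ultimately show ?thesis
    unfolding S.miss_def S.mean_def joint_seqs lr_seqs
    by (intro exI[of _ c] exI[of _ g] exI[of _ \<delta>]) (rule order_trans)
qed

end

text \<open>The law of large numbers for a log density, with generic \<open>A\<close> and
  \<open>B\<close> so that both decoding tests and the covering tail are instances. Positivity on
  the support of \<open>J\<close> is enough: a sequence with a letter tuple off the support has
  weight 0.\<close>

lemma ratio_tail:
  fixes A B :: "'x \<Rightarrow> 'y \<Rightarrow> 'u \<Rightarrow> 'z \<Rightarrow> real"
  assumes pos: "\<And>x y u z. J x y u z \<noteq> 0 \<Longrightarrow> 0 < A x y u z \<and> 0 < B x y u z"
    and \<epsilon>: "0 < \<epsilon>"
  shows "\<exists>\<rho>\<ge>0. \<rho> < 1 \<and> (\<forall>n. (\<Sum>x\<in>seqs n. \<Sum>y\<in>seqs n. \<Sum>u\<in>seqs n. \<Sum>z\<in>seqs n.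
      (\<Prod>i<n. J (x i) (y i) (u i) (z i)) * of_bool (\<not>
        2 powr (n * (EJ (\<lambda>x y u z. log 2 (A x y u z / B x y u z)) - \<epsilon>)) * (\<Prod>i<n. B (x i) (y i) (u i) (z i))
        \<le> (\<Prod>i<n. A (x i) (y i) (u i) (z i)))) \<le> \<rho> ^ n)"
proof -
  define I where "I = EJ (\<lambda>x y u z. log 2 (A x y u z / B x y u z))"
  \<comment> \<open>The test fails when the density falls below its mean, hence the sign:
    \<open>chernoff_bound\<close> controls upper tails.\<close>
  define g where "g x y u z = - log 2 (A x y u z / B x y u z)" for x y u z
  have "(\<Sum>x\<in>UNIV. \<Sum>y\<in>UNIV. \<Sum>u\<in>UNIV. \<Sum>z\<in>UNIV. J x y u z * g x y u z) < \<epsilon> - I"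
    using \<epsilon> by (simp add: I_def EJ_def g_def sum_negf)
  from chernoff_bound[OF J_nonneg sum_J this]
  obtain \<rho> where \<rho>: "0 \<le> \<rho>" "\<rho> < 1" "\<And>n. (\<Sum>x\<in>seqs n. \<Sum>y\<in>seqs n. \<Sum>u\<in>seqs n. \<Sum>z\<in>seqs n.
      (\<Prod>i<n. J (x i) (y i) (u i) (z i)) * of_bool (n * (\<epsilon> - I) \<le> (\<Sum>i<n. g (x i) (y i) (u i) (z i)))) \<le> \<rho> ^ n"
    by blast
  have "(\<Sum>x\<in>seqs n. \<Sum>y\<in>seqs n. \<Sum>u\<in>seqs n. \<Sum>z\<in>seqs n.
      (\<Prod>i<n. J (x i) (y i) (u i) (z i)) * of_bool (\<not>
        2 powr (n * (I - \<epsilon>)) * (\<Prod>i<n. B (x i) (y i) (u i) (z i)) \<le> (\<Prod>i<n. A (x i) (y i) (u i) (z i))))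
    \<le> (\<Sum>x\<in>seqs n. \<Sum>y\<in>seqs n. \<Sum>u\<in>seqs n. \<Sum>z\<in>seqs n.
      (\<Prod>i<n. J (x i) (y i) (u i) (z i)) * of_bool (n * (\<epsilon> - I) \<le> (\<Sum>i<n. g (x i) (y i) (u i) (z i))))" for n
  proof (rule sum4_mono)
    fix x :: "nat \<Rightarrow> 'x" and y :: "nat \<Rightarrow> 'y" and u :: "nat \<Rightarrow> 'u" and z :: "nat \<Rightarrow> 'z"
    let ?J = "\<Prod>i<n. J (x i) (y i) (u i) (z i)" and ?A = "\<lambda>i. A (x i) (y i) (u i) (z i)"
      and ?B = "\<lambda>i. B (x i) (y i) (u i) (z i)" and ?g = "\<lambda>i. g (x i) (y i) (u i) (z i)"
    have J0: "0 \<le> ?J"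
      by (intro prod_nonneg J_nonneg)
    show "?J * of_bool (\<not> 2 powr (n * (I - \<epsilon>)) * (\<Prod>i<n. ?B i) \<le> (\<Prod>i<n. ?A i))
        \<le> ?J * of_bool (n * (\<epsilon> - I) \<le> (\<Sum>i<n. ?g i))"
    proof (cases "?J = 0")
      case False
      then have AB: "0 < ?A i" "0 < ?B i" if "i < n" for i
        using pos that by auto
      have "(\<Prod>i<n. ?A i) = (\<Prod>i<n. ?A i / ?B i) * (\<Prod>i<n. ?B i)"
        unfolding prod.distrib[symmetric] using AB by (intro prod.cong) (force simp: field_simps)+
      also have "(\<Prod>i<n. ?A i / ?B i) = (\<Prod>i<n. 2 powr (- ?g i))"
        using AB by (intro prod.cong) (auto simp: g_def)
      also have "\<dots> = 2 powr (- (\<Sum>i<n. ?g i))"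
        by (simp add: powr_sum flip: sum_negf)
      finally have A: "(\<Prod>i<n. ?A i) = 2 powr (- (\<Sum>i<n. ?g i)) * (\<Prod>i<n. ?B i)" .
      have "0 < (\<Prod>i<n. ?B i)"
        using AB by (intro prod_pos) auto
      then have "n * (\<epsilon> - I) \<le> (\<Sum>i<n. ?g i)"
        if "\<not> 2 powr (n * (I - \<epsilon>)) * (\<Prod>i<n. ?B i) \<le> (\<Prod>i<n. ?A i)"
        using that unfolding A by (simp add: not_le algebra_simps)
      then show ?thesis
        using J0 by (intro mult_left_mono) auto
    qed (simp only: mult_zero_left order_refl)
  qed
  then have "(\<Sum>x\<in>seqs n. \<Sum>y\<in>seqs n. \<Sum>u\<in>seqs n. \<Sum>z\<in>seqs n.
      (\<Prod>i<n. J (x i) (y i) (u i) (z i)) * of_bool (\<not>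
        2 powr (n * (I - \<epsilon>)) * (\<Prod>i<n. B (x i) (y i) (u i) (z i)) \<le> (\<Prod>i<n. A (x i) (y i) (u i) (z i))))
      \<le> \<rho> ^ n" for n
    using \<rho>(3) order_trans by blast
  then show ?thesis
    unfolding I_def using \<rho>(1,2) by blast
qed

lemma atypical_tail:
  assumes "0 < \<epsilon>"
  shows "\<exists>\<rho> \<sigma>. 0 \<le> \<rho> \<and> \<rho> < 1 \<and> 0 \<le> \<sigma> \<and> \<sigma> < 1 \<and> (\<forall>n. (\<Sum>x\<in>seqs n. \<Sum>y\<in>seqs n. \<Sum>u\<in>seqs n. \<Sum>z\<in>seqs n.
      (\<Prod>i<n. J (x i) (y i) (u i) (z i)) * of_bool (\<not> typical \<epsilon> n x u z)) \<le> \<rho> ^ n + \<sigma> ^ n)"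
proof -
  let ?P = "\<lambda>(n :: nat) (x :: nat \<Rightarrow> 'x) (u :: nat \<Rightarrow> 'u) (z :: nat \<Rightarrow> 'z). 2 powr (n * (I_direct - \<epsilon>)) * (\<Prod>i<n. p (x i) * Juz (u i) (z i)) \<le> (\<Prod>i<n. Jxuz (x i) (u i) (z i))"
  let ?Q = "\<lambda>(n :: nat) (x :: nat \<Rightarrow> 'x) (u :: nat \<Rightarrow> 'u) (z :: nat \<Rightarrow> 'z). 2 powr (n * (I_joint - \<epsilon>)) * (\<Prod>i<n. p (x i) * Ju (u i) * Jz (z i)) \<le> (\<Prod>i<n. Jxuz (x i) (u i) (z i))"
  let ?S = "\<lambda>n P. \<Sum>x\<in>seqs n. \<Sum>y\<in>seqs n. \<Sum>u\<in>seqs n. \<Sum>z\<in>seqs n.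
      (\<Prod>i<n. J (x i) (y i) (u i) (z i)) * of_bool (\<not> P n x u z)"
  obtain \<rho> where \<rho>: "0 \<le> \<rho>" "\<rho> < 1" "\<And>n. ?S n ?P \<le> \<rho> ^ n"
    using ratio_tail[of "\<lambda>x y u z. Jxuz x u z" "\<lambda>x y u z. p x * Juz u z" \<epsilon>] marginals_pos assms
    unfolding I_direct_def by auto
  obtain \<sigma> where \<sigma>: "0 \<le> \<sigma>" "\<sigma> < 1" "\<And>n. ?S n ?Q \<le> \<sigma> ^ n"
    using ratio_tail[of "\<lambda>x y u z. Jxuz x u z" "\<lambda>x y u z. p x * Ju u * Jz z" \<epsilon>] marginals_pos assms
    unfolding I_joint_def by auto
  have "?S n (typical \<epsilon>) \<le> ?S n ?P + ?S n ?Q" for n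
    unfolding sum.distrib[symmetric] distrib_left[symmetric]
    by (intro sum_mono mult_left_mono prod_nonneg J_nonneg) (auto simp: typical_def)
  then have "?S n (typical \<epsilon>) \<le> \<rho> ^ n + \<sigma> ^ n" for n
    by (rule order_trans[OF _ add_mono[OF \<rho>(3) \<sigma>(3)]])
  then show ?thesis
    using \<rho>(1,2) \<sigma>(1,2) by blast
qed

text \<open>An upper deviation of a likelihood ratio is a lower deviation of its inverse, so
  \<open>ratio_tail\<close> applies with \<open>Ju u\<close> over \<open>q y u\<close>, whose mean
  log is \<open>- I_cover\<close>.\<close>

lemma covering_tail:
  assumes "0 < \<epsilon>"
  shows "\<exists>\<rho>\<ge>0. \<rho> < 1 \<and> (\<forall>n. (\<Sum>x\<in>seqs n. \<Sum>y\<in>seqs n. \<Sum>u\<in>seqs n. \<Sum>z\<in>seqs n.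
      (\<Prod>i<n. J (x i) (y i) (u i) (z i)) *
        of_bool ((\<Prod>i<n. q (y i) (u i) / Ju (u i)) > 2 powr (n * (I_cover + \<epsilon>)))) \<le> \<rho> ^ n)"
proof -
  have I: "EJ (\<lambda>x y u z. log 2 (Ju u / q y u)) = - I_cover"
    unfolding I_cover_def EJ_def sum_negf[symmetric]
  proof (intro sum.cong refl)
    fix x y u z
    show "J x y u z * log 2 (Ju u / q y u) = - (J x y u z * log 2 (q y u / Ju u))"
      using marginals_pos[of x y u z] by (cases "J x y u z = 0") (auto simp: log_divide algebra_simps)
  qed
  obtain \<rho> where \<rho>: "0 \<le> \<rho>" "\<rho> < 1" "\<And>n. (\<Sum>x\<in>seqs n. \<Sum>y\<in>seqs n. \<Sum>u\<in>seqs n. \<Sum>z\<in>seqs n.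
      (\<Prod>i<n. J (x i) (y i) (u i) (z i)) * of_bool (\<not>
        2 powr (n * (- I_cover - \<epsilon>)) * (\<Prod>i<n. q (y i) (u i)) \<le> (\<Prod>i<n. Ju (u i)))) \<le> \<rho> ^ n"
    using ratio_tail[of "\<lambda>x y u z. Ju u" "\<lambda>x y u z. q y u" \<epsilon>] marginals_pos assms
    unfolding I by auto
  have "(\<Sum>x\<in>seqs n. \<Sum>y\<in>seqs n. \<Sum>u\<in>seqs n. \<Sum>z\<in>seqs n.
      (\<Prod>i<n. J (x i) (y i) (u i) (z i)) *
        of_bool ((\<Prod>i<n. q (y i) (u i) / Ju (u i)) > 2 powr (n * (I_cover + \<epsilon>))))
    \<le> (\<Sum>x\<in>seqs n. \<Sum>y\<in>seqs n. \<Sum>u\<in>seqs n. \<Sum>z\<in>seqs n.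
      (\<Prod>i<n. J (x i) (y i) (u i) (z i)) * of_bool (\<not>
        2 powr (n * (- I_cover - \<epsilon>)) * (\<Prod>i<n. q (y i) (u i)) \<le> (\<Prod>i<n. Ju (u i))))" for n
  proof (intro sum4_mono mult_left_mono prod_nonneg J_nonneg)
    fix y :: "nat \<Rightarrow> 'y" and u :: "nat \<Rightarrow> 'u"
    let ?q = "\<Prod>i<n. q (y i) (u i)" and ?u = "\<Prod>i<n. Ju (u i)"
    have "\<not> 2 powr (n * (- I_cover - \<epsilon>)) * ?q \<le> ?u"
      if gt: "(\<Prod>i<n. q (y i) (u i) / Ju (u i)) > 2 powr (n * (I_cover + \<epsilon>))"
    proof -
      have gt': "2 powr (n * (I_cover + \<epsilon>)) < ?q / ?u"
        using gt by (simp add: prod_dividef)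
      \<comment> \<open>If \<open>?u\<close> were 0 the quotient would be 0 by convention and could
        not exceed a power of 2.\<close>
      have "?u \<noteq> 0"
        using gt' by (metis div_by_0 less_asym powr_gt_zero zero_neq_numeral)
      then have u: "0 < ?u"
        using prod_nonneg[of "{..<n}" "\<lambda>i. Ju (u i)"] marginals_nonneg by (simp add: less_le)
      have eq: "2 powr (n * (- I_cover - \<epsilon>)) = inverse (2 powr (n * (I_cover + \<epsilon>)))"
        unfolding powr_minus[symmetric] by (rule arg_cong[where f = "(powr) 2"]) (simp add: algebra_simps)
      have "\<not> inverse A * ?q \<le> ?u" if "0 < A" "A < ?q / ?u" for A
        using that u by (simp add: field_simps not_le)
      from this[OF _ gt'] show ?thesis
        unfolding eq by simp
    qed
    then show "of_bool ((\<Prod>i<n. q (y i) (u i) / Ju (u i)) > 2 powr (n * (I_cover + \<epsilon>)))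
        \<le> (of_bool (\<not> 2 powr (n * (- I_cover - \<epsilon>)) * ?q \<le> ?u) :: real)"
      by auto
  qed
  then have "(\<Sum>x\<in>seqs n. \<Sum>y\<in>seqs n. \<Sum>u\<in>seqs n. \<Sum>z\<in>seqs n.
      (\<Prod>i<n. J (x i) (y i) (u i) (z i)) *
        of_bool ((\<Prod>i<n. q (y i) (u i) / Ju (u i)) > 2 powr (n * (I_cover + \<epsilon>)))) \<le> \<rho> ^ n" for n
    using \<rho>(3) order_trans by blast
  then show ?thesis
    using \<rho>(1,2) by blast
qed

theorem codes_exist:
  assumes R: "0 \<le> R" "R < I_direct" "R < I_joint - I_cover"
  shows "\<exists>b. b \<longlonglongrightarrow> 0 \<and> (\<forall>n. \<exists>(c :: nat \<Rightarrow> nat \<Rightarrow> 'x) (g :: (nat \<Rightarrow> 'y) \<Rightarrow> nat \<Rightarrow> 'u) (\<delta> :: (nat \<Rightarrow> 'z) \<Rightarrow> nat).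
    1 / num_messages R n * (\<Sum>m\<in>{1..num_messages R n}. \<Sum>y\<in>seqs n. \<Sum>z\<in>seqs n. (\<Prod>i<n. W (c m i) (y i)) *
      (\<Prod>i<n. V (c m i) (g y i) (y i) (z i)) * of_bool (\<delta> z \<noteq> m)) \<le> b n)"
proof -
  \<comment> \<open>The relay rate exceeds \<open>I_cover\<close> by \<open>2 * \<epsilon>\<close>
    and the truncation level \<open>a\<close> sits halfway, so that both the covering tail and
    \<open>sqrt (a / L)\<close> decay. With the \<open>\<epsilon>\<close> given up in the second
    test, wrong pairs cost \<open>3 * \<epsilon>\<close>; a quarter of the smaller gap keeps that
    exponent negative.\<close>
  define \<epsilon> where "\<epsilon> = min (I_direct - R) (I_joint - I_cover - R) / 4"
  have \<epsilon>: "0 < \<epsilon>" "R - I_direct + \<epsilon> < 0" "R + I_cover - I_joint + 3 * \<epsilon> < 0"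
    using R by (auto simp: \<epsilon>_def min_def field_simps)
  obtain \<rho> \<sigma> where \<rho>: "0 \<le> \<rho>" "\<rho> < 1" and \<sigma>: "0 \<le> \<sigma>" "\<sigma> < 1"
    and at: "\<And>n. (\<Sum>x\<in>seqs n. \<Sum>y\<in>seqs n. \<Sum>u\<in>seqs n. \<Sum>z\<in>seqs n.
      (\<Prod>i<n. J (x i) (y i) (u i) (z i)) * of_bool (\<not> typical \<epsilon> n x u z)) \<le> \<rho> ^ n + \<sigma> ^ n"
    using atypical_tail[OF \<epsilon>(1)] by blast
  obtain \<tau> where \<tau>: "0 \<le> \<tau>" "\<tau> < 1" and ct: "\<And>n. (\<Sum>x\<in>seqs n. \<Sum>y\<in>seqs n. \<Sum>u\<in>seqs n. \<Sum>z\<in>seqs n.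
      (\<Prod>i<n. J (x i) (y i) (u i) (z i)) *
        of_bool ((\<Prod>i<n. q (y i) (u i) / Ju (u i)) > 2 powr (n * (I_cover + \<epsilon>)))) \<le> \<tau> ^ n"
    using covering_tail[OF \<epsilon>(1)] by blast
  \<comment> \<open>The factors 2 and 4 come from rounding up in \<open>num_messages\<close>, which
    at most doubles each codebook size; the square root halves the covering exponent.\<close>
  define b where "b n = \<rho> ^ n + \<sigma> ^ n + 2 * (2 powr (R - I_direct + \<epsilon>)) ^ n
      + 4 * (2 powr (R + I_cover - I_joint + 3 * \<epsilon>)) ^ n + ((2 powr (- \<epsilon> / 2)) ^ n + 2 * \<tau> ^ n)" for n
  have small: "2 powr r < 1" if "r < 0" for r :: real
    using that powr_less_mono[of r 0 2] by simp
  have "b \<longlonglongrightarrow> 0 + 0 + 2 * 0 + 4 * 0 + (0 + 2 * 0)"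
    unfolding b_def using \<rho> \<sigma> \<tau> \<epsilon>
    by (intro tendsto_add tendsto_mult tendsto_const LIMSEQ_realpow_zero small) auto
  moreover have "\<exists>(c :: nat \<Rightarrow> nat \<Rightarrow> 'x) (g :: (nat \<Rightarrow> 'y) \<Rightarrow> nat \<Rightarrow> 'u) (\<delta> :: (nat \<Rightarrow> 'z) \<Rightarrow> nat).
    1 / num_messages R n * (\<Sum>m\<in>{1..num_messages R n}. \<Sum>y\<in>seqs n. \<Sum>z\<in>seqs n. (\<Prod>i<n. W (c m i) (y i)) *
      (\<Prod>i<n. V (c m i) (g y i) (y i) (z i)) * of_bool (\<delta> z \<noteq> m)) \<le> b n" for n
  proof -
    let ?M = "num_messages R n" and ?L = "num_messages (I_cover + 2 * \<epsilon>) n"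
    let ?a = "2 powr (n * (I_cover + \<epsilon>))"
    have pw: "(2 powr r) ^ n = 2 powr (n * r)" for r :: real
      by (simp add: powr_power mult.commute)
    have M: "?M \<le> 2 * 2 powr (n * R)"
      by (rule num_messages_le[OF R(1)])
    have L: "?L \<le> 2 * 2 powr (n * (I_cover + 2 * \<epsilon>))"
      using I_cover_nonneg \<epsilon>(1) by (intro num_messages_le) auto
    have t1: "?M * 2 powr (- (n * (I_direct - \<epsilon>))) \<le> 2 * (2 powr (R - I_direct + \<epsilon>)) ^ n"
    proof -
      have "?M * 2 powr (- (n * (I_direct - \<epsilon>))) \<le> 2 * 2 powr (n * R) * 2 powr (- (n * (I_direct - \<epsilon>)))"
        using M by (intro mult_right_mono) auto
      also have "\<dots> = 2 * 2 powr (n * R + - (n * (I_direct - \<epsilon>)))"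
        unfolding powr_add by simp
      finally show ?thesis
        unfolding pw by (simp add: algebra_simps)
    qed
    have t2: "real ?M * real ?L * 2 powr (- (n * (I_joint - \<epsilon>))) \<le> 4 * (2 powr (R + I_cover - I_joint + 3 * \<epsilon>)) ^ n"
    proof -
      have "real ?M * real ?L * 2 powr (- (n * (I_joint - \<epsilon>)))
          \<le> (2 * 2 powr (n * R)) * (2 * 2 powr (n * (I_cover + 2 * \<epsilon>))) * 2 powr (- (n * (I_joint - \<epsilon>)))"
        using M L by (intro mult_right_mono mult_mono) auto
      also have "\<dots> = 4 * 2 powr (n * R + n * (I_cover + 2 * \<epsilon>) + - (n * (I_joint - \<epsilon>)))"
        unfolding powr_add by simp
      finally show ?thesis
        unfolding pw by (simp add: algebra_simps)
    qed
    have t3: "sqrt (?a / ?L) \<le> (2 powr (- \<epsilon> / 2)) ^ n"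
    proof (rule real_le_lsqrt)
      have "?a / ?L \<le> ?a / 2 powr (n * (I_cover + 2 * \<epsilon>))"
        using num_messages_ge[of n "I_cover + 2 * \<epsilon>"] num_messages_pos[of "I_cover + 2 * \<epsilon>" n]
        by (intro divide_left_mono) auto
      also have "\<dots> = 2 powr (n * (I_cover + \<epsilon>) - n * (I_cover + 2 * \<epsilon>))"
        by (simp add: powr_diff)
      also have "\<dots> = 2 powr (n * (- \<epsilon> / 2) + n * (- \<epsilon> / 2))"
        by (simp add: algebra_simps)
      also have "\<dots> = ((2 powr (- \<epsilon> / 2)) ^ n)\<^sup>2"
        unfolding pw powr_add by (simp add: power2_eq_square)
      finally show "?a / ?L \<le> ((2 powr (- \<epsilon> / 2)) ^ n)\<^sup>2" .
    qed auto
    have "0 < ?a"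
      by simp
    from seqs_code[where M = ?M and L = ?L and n = n and \<epsilon> = \<epsilon>, OF num_messages_pos num_messages_pos this]
    obtain c g \<delta> where cg: "1 / ?M * (\<Sum>m\<in>{1..?M}. \<Sum>y\<in>seqs n. \<Sum>z\<in>seqs n. (\<Prod>i<n. W (c m i) (y i)) *
      (\<Prod>i<n. V (c m i) (g y i) (y i) (z i)) * of_bool (\<delta> z \<noteq> m))
    \<le> (\<Sum>x\<in>seqs n. \<Sum>y\<in>seqs n. \<Sum>u\<in>seqs n. \<Sum>z\<in>seqs n.
          (\<Prod>i<n. J (x i) (y i) (u i) (z i)) * of_bool (\<not> typical \<epsilon> n x u z))
      + ?M * 2 powr (- (n * (I_direct - \<epsilon>))) + real ?M * real ?L * 2 powr (- (n * (I_joint - \<epsilon>)))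
      + (sqrt (?a / ?L) + 2 * (\<Sum>x\<in>seqs n. \<Sum>y\<in>seqs n. \<Sum>u\<in>seqs n. \<Sum>z\<in>seqs n.
          (\<Prod>i<n. J (x i) (y i) (u i) (z i)) * of_bool ((\<Prod>i<n. q (y i) (u i) / Ju (u i)) > ?a)))"
      (is "?lhs \<le> ?rhs")
      by blast
    have "?rhs \<le> b n"
      unfolding b_def by (intro add_mono at t1 t2 t3 mult_left_mono ct) auto
    with cg show ?thesis
      by (intro exI[of _ c] exI[of _ g] exI[of _ \<delta>]) (rule order_trans)
  qed
  ultimately show ?thesis
    by auto
qed

end

subsection \<open>Single-letter quantities\<close>

lemma sum_pmf_map:
  fixes P :: "'a::finite pmf" and g :: "'a \<Rightarrow> 'b::finite" and h :: "'b \<Rightarrow> real"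
  shows "(\<Sum>b\<in>UNIV. pmf (map_pmf g P) b * h b) = (\<Sum>a\<in>UNIV. pmf P a * h (g a))"
proof -
  have "(\<Sum>b\<in>UNIV. pmf (map_pmf g P) b * h b) = measure_pmf.expectation (map_pmf g P) h"
    by (subst integral_measure_pmf_real[of UNIV]) (auto simp: mult.commute)
  also have "\<dots> = (\<Sum>a\<in>UNIV. pmf P a * h (g a))"
    by (simp, subst integral_measure_pmf_real[of UNIV]) (auto simp: mult.commute)
  finally show ?thesis .
qed

lemma pmf_map_eq_sum:
  fixes P :: "'a::finite pmf" and g :: "'a \<Rightarrow> 'b::finite"
  shows "pmf (map_pmf g P) b = (\<Sum>a\<in>UNIV. pmf P a * of_bool (g a = b))"
  using sum_pmf_map[of g P "\<lambda>b'. of_bool (b' = b)"] by (simp add: of_bool_def if_distrib[of "\<lambda>t. _ * t"] cong: if_cong)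

lemma sum_pmf_bind:
  fixes N :: "'a::finite pmf" and F :: "'a \<Rightarrow> 'b::finite pmf" and h :: "'b \<Rightarrow> real"
  shows "(\<Sum>b\<in>UNIV. pmf (bind_pmf N F) b * h b) = (\<Sum>a\<in>UNIV. pmf N a * (\<Sum>b\<in>UNIV. pmf (F a) b * h b))"
proof -
  have "pmf (bind_pmf N F) b = (\<Sum>a\<in>UNIV. pmf N a * pmf (F a) b)" for b
    unfolding pmf_bind by (subst integral_measure_pmf_real[of UNIV]) (auto simp: mult.commute)
  then have "(\<Sum>b\<in>UNIV. pmf (bind_pmf N F) b * h b) = (\<Sum>b\<in>UNIV. \<Sum>a\<in>UNIV. pmf N a * (pmf (F a) b * h b))"
    by (simp add: sum_distrib_right mult.assoc)
  also have "\<dots> = (\<Sum>a\<in>UNIV. \<Sum>b\<in>UNIV. pmf N a * (pmf (F a) b * h b))"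
    by (rule sum.swap)
  finally show ?thesis
    by (simp add: sum_distrib_left)
qed

text \<open>The case split of the definition disappears because a zero probability annihilates its
  summand whatever the logarithm is. What remains is an expectation over outcomes, ready to be
  compared with \<open>EJ\<close>.\<close>

lemma mutual_info_eq_sum:
  fixes P :: "'a::finite pmf" and X :: "'a \<Rightarrow> 'b::finite" and Y :: "'a \<Rightarrow> 'c::finite"
  shows "mutual_info P X Y = (\<Sum>a\<in>UNIV. pmf P a * log 2 (pmf (map_pmf (\<lambda>a. (X a, Y a)) P) (X a, Y a)
    / (pmf (map_pmf X P) (X a) * pmf (map_pmf Y P) (Y a))))"
proof -
  have "mutual_info P X Y = (\<Sum>b\<in>UNIV. \<Sum>c\<in>UNIV. pmf (map_pmf (\<lambda>a. (X a, Y a)) P) (b, c) *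
      log 2 (pmf (map_pmf (\<lambda>a. (X a, Y a)) P) (b, c) / (pmf (map_pmf X P) b * pmf (map_pmf Y P) c)))"
    unfolding mutual_info_def Let_def by (intro sum.cong) auto
  also have "\<dots> = (\<Sum>t\<in>UNIV. pmf (map_pmf (\<lambda>a. (X a, Y a)) P) t *
      log 2 (pmf (map_pmf (\<lambda>a. (X a, Y a)) P) t / (pmf (map_pmf X P) (fst t) * pmf (map_pmf Y P) (snd t))))"
    unfolding sum.cartesian_product by (simp add: case_prod_unfold)
  finally show ?thesis
    unfolding sum_pmf_map by simp
qed

lemma cond_mutual_info_eq_sum:
  fixes P :: "'a::finite pmf" and X :: "'a \<Rightarrow> 'b::finite" and Y :: "'a \<Rightarrow> 'c::finite" and Z :: "'a \<Rightarrow> 'd::finite"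
  shows "cond_mutual_info P X Y Z = (\<Sum>a\<in>UNIV. pmf P a * log 2
    (pmf (map_pmf (\<lambda>a. (X a, Y a, Z a)) P) (X a, Y a, Z a) * pmf (map_pmf Z P) (Z a)
    / (pmf (map_pmf (\<lambda>a. (X a, Z a)) P) (X a, Z a) * pmf (map_pmf (\<lambda>a. (Y a, Z a)) P) (Y a, Z a))))"
proof -
  let ?Q = "map_pmf (\<lambda>a. (X a, Y a, Z a)) P"
  have "cond_mutual_info P X Y Z = (\<Sum>b\<in>UNIV. \<Sum>c\<in>UNIV. \<Sum>d\<in>UNIV. pmf ?Q (b, c, d) *
      log 2 (pmf ?Q (b, c, d) * pmf (map_pmf Z P) d
    / (pmf (map_pmf (\<lambda>a. (X a, Z a)) P) (b, d) * pmf (map_pmf (\<lambda>a. (Y a, Z a)) P) (c, d))))"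
    unfolding cond_mutual_info_def Let_def by (intro sum.cong) auto
  also have "\<dots> = (\<Sum>t\<in>UNIV. pmf ?Q t *
      log 2 (pmf ?Q t * pmf (map_pmf Z P) (snd (snd t))
    / (pmf (map_pmf (\<lambda>a. (X a, Z a)) P) (fst t, snd (snd t)) * pmf (map_pmf (\<lambda>a. (Y a, Z a)) P) (fst (snd t), snd (snd t)))))"
    unfolding sum.cartesian_product by (simp add: case_prod_unfold)
  finally show ?thesis
    unfolding sum_pmf_map by simp
qed

section \<open>The relay channel as an instance of the memoryless setting\<close>

lemma relay_joint_expectation:
  fixes W2 :: "'x1::finite \<Rightarrow> 'y2::finite pmf"
    and W3 :: "'x1 \<Rightarrow> 'x2::finite \<Rightarrow> 'y2 \<Rightarrow> 'y3::finite pmf"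
    and pu :: "'y2 \<Rightarrow> 'u::finite pmf" and h :: "'x1 \<times> 'y2 \<times> 'u \<times> 'x2 \<times> 'y3 \<Rightarrow> real"
  shows "(\<Sum>a\<in>UNIV. pmf (relay_joint W2 W3 px1 pu f) a * h a)
    = (\<Sum>x\<in>UNIV. \<Sum>y\<in>UNIV. \<Sum>u\<in>UNIV. \<Sum>z\<in>UNIV.
        pmf px1 x * pmf (W2 x) y * pmf (pu y) u * pmf (W3 x (f u y) y) z * h (x, y, u, f u y, z))"
  unfolding relay_joint_def
  by (simp only: sum_pmf_bind sum_pmf_map) (simp add: sum_distrib_left mult.assoc)

lemma sum_lists_eq_sum_seqs:
  fixes F :: "(nat \<Rightarrow> 'a) \<Rightarrow> real"
  shows "(\<Sum>ys\<in>{ys. length ys = n}. F (\<lambda>i\<in>{..<n}. ys ! i)) = (\<Sum>y\<in>seqs n. F y)"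
proof (rule sum.reindex_bij_witness[where i = "\<lambda>y. map y [0..<n]" and j = "\<lambda>ys. \<lambda>i\<in>{..<n}. ys ! i"])
  fix ys :: "'a list" assume "ys \<in> {ys. length ys = n}"
  then show "map (\<lambda>i\<in>{..<n}. ys ! i) [0..<n] = ys"
    by (auto intro!: nth_equalityI)
next
  fix y :: "nat \<Rightarrow> 'a" assume "y \<in> seqs n"
  then show "(\<lambda>i\<in>{..<n}. map y [0..<n] ! i) = y"
    by (auto simp: fun_eq_iff restrict_def PiE_def extensional_def)
qed auto

locale dm_relay =
  fixes W2 :: "'x1::finite \<Rightarrow> 'y2::finite pmf"
    and W3 :: "'x1 \<Rightarrow> 'x2::finite \<Rightarrow> 'y2 \<Rightarrow> 'y3::finite pmf"
    and px1 :: "'x1 pmf"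
    and pu :: "'y2 \<Rightarrow> 'u::finite pmf"
    and f :: "'u \<Rightarrow> 'y2 \<Rightarrow> 'x2"
begin

text \<open>The map \<open>f\<close> is absorbed into the channel: given U and Y2 the relay input is
  determined, so Y3 is seen through a channel with inputs X1, U, Y2.\<close>

sublocale memoryless_relay "pmf px1" "\<lambda>x. pmf (W2 x)" "\<lambda>y. pmf (pu y)" "\<lambda>x u y. pmf (W3 x (f u y) y)"
  by unfold_locales (auto intro: sum_pmf_eq_1)

abbreviation "P \<equiv> relay_joint W2 W3 px1 pu f"

definition Jxu :: "'x1 \<Rightarrow> 'u \<Rightarrow> real" where
  "Jxu x u = (\<Sum>y\<in>UNIV. \<Sum>z\<in>UNIV. J x y u z)"

lemma expectation_P: "(\<Sum>a\<in>UNIV. pmf P a * h a) = EJ (\<lambda>x y u z. h (x, y, u, f u y, z))"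
  unfolding relay_joint_expectation EJ_def J_def ..

lemma pmf_map_P:
  fixes g :: "_ \<Rightarrow> 'b::finite"
  shows "pmf (map_pmf g P) b = EJ (\<lambda>x y u z. of_bool (g (x, y, u, f u y, z) = b))"
  unfolding pmf_map_eq_sum expectation_P ..

lemma sum_UNIV_mult_of_bool: "(\<Sum>x\<in>UNIV. F x * of_bool (x = (a :: 'a::finite))) = (F a :: real)"
  by (simp add: of_bool_def if_distrib[of "\<lambda>t. _ * t"] cong: if_cong)

text \<open>The projections are written with \<open>case\<close>, the form in which the tuple
  patterns of the final statement appear after unfolding, so that they can serve as rewrite
  rules.\<close>

lemma P_marginals:
  "pmf (map_pmf (\<lambda>a. case a of (x1, y2, u, x2, y3) \<Rightarrow> x1) P) x = pmf px1 x"
  "pmf (map_pmf (\<lambda>a. case a of (x1, y2, u, x2, y3) \<Rightarrow> y3) P) z = Jz z"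
  "pmf (map_pmf (\<lambda>a. case a of (x1, y2, u, x2, y3) \<Rightarrow> (u, y3)) P) (u, z) = Juz u z"
  "pmf (map_pmf (\<lambda>a. case a of (x1, y2, u, x2, y3) \<Rightarrow> (x1, u)) P) (x, u) = Jxu x u"
  "pmf (map_pmf (\<lambda>a. (case a of (x1, y2, u, x2, y3) \<Rightarrow> u, case a of (x1, y2, u, x2, y3) \<Rightarrow> x1)) P) (u, x) = Jxu x u"
  "pmf (map_pmf (\<lambda>a. (case a of (x1, y2, u, x2, y3) \<Rightarrow> y2, case a of (x1, y2, u, x2, y3) \<Rightarrow> x1)) P) (y, x)
    = pmf px1 x * pmf (W2 x) y"
  "pmf (map_pmf (\<lambda>a. (case a of (x1, y2, u, x2, y3) \<Rightarrow> u, case a of (x1, y2, u, x2, y3) \<Rightarrow> y2,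
      case a of (x1, y2, u, x2, y3) \<Rightarrow> x1)) P) (u, y, x) = pmf px1 x * pmf (W2 x) y * pmf (pu y) u"
  "pmf (map_pmf (\<lambda>a. (case a of (x1, y2, u, x2, y3) \<Rightarrow> x1, case a of (x1, y2, u, x2, y3) \<Rightarrow> (u, y3))) P) (x, u, z)
    = Jxuz x u z"
  "pmf (map_pmf (\<lambda>a. (case a of (x1, y2, u, x2, y3) \<Rightarrow> (x1, u), case a of (x1, y2, u, x2, y3) \<Rightarrow> y3)) P) ((x, u), z)
    = Jxuz x u z"
  unfolding pmf_map_P EJ_def Jz_def Juz_def Jxu_def Jxuz_def
  by (simp_all add: of_bool_conj sum_UNIV_mult_of_bool mult.assoc[symmetric] flip: sum_distrib_right)
     (simp_all add: J_def sum1 flip: sum_distrib_left)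

lemma mutual_info_direct:
  "mutual_info P (\<lambda>(x1, y2, u, x2, y3). x1) (\<lambda>(x1, y2, u, x2, y3). (u, y3)) = I_direct"
  unfolding mutual_info_eq_sum expectation_P I_direct_def by (simp add: P_marginals)

lemma Jxu_pos:
  assumes "J x y u z \<noteq> 0"
  shows "0 < Jxu x u"
proof -
  have "0 < J x y u z"
    using assms J_nonneg[of x y u z] by linarith
  then show ?thesis
    unfolding Jxu_def
    by (intro sum_pos2[of _ y] sum_pos2[of _ z]) (auto simp: J_nonneg intro!: sum_nonneg)
qed

text \<open>The Markov chain \<open>X1 - Y2 - U\<close> gives \<open>I(U;Y2|X1) = I(U;Y2) - I(U;X1)\<close>; in terms of
  densities the resulting identity holds pointwise.\<close>

lemma mutual_info_relay:
  "mutual_info P (\<lambda>(x1, y2, u, x2, y3). (x1, u)) (\<lambda>(x1, y2, u, x2, y3). y3)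
    - cond_mutual_info P (\<lambda>(x1, y2, u, x2, y3). u) (\<lambda>(x1, y2, u, x2, y3). y2) (\<lambda>(x1, y2, u, x2, y3). x1)
    = I_joint - I_cover"
proof -
  have "mutual_info P (\<lambda>(x1, y2, u, x2, y3). (x1, u)) (\<lambda>(x1, y2, u, x2, y3). y3)
      = EJ (\<lambda>x y u z. log 2 (Jxuz x u z / (Jxu x u * Jz z)))"
    unfolding mutual_info_eq_sum expectation_P by (simp add: P_marginals)
  moreover have "cond_mutual_info P (\<lambda>(x1, y2, u, x2, y3). u) (\<lambda>(x1, y2, u, x2, y3). y2) (\<lambda>(x1, y2, u, x2, y3). x1)
      = EJ (\<lambda>x y u z. log 2 (pmf px1 x * pmf (W2 x) y * pmf (pu y) u * pmf px1 x
          / (Jxu x u * (pmf px1 x * pmf (W2 x) y))))"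
    unfolding cond_mutual_info_eq_sum expectation_P by (simp add: P_marginals)
  moreover have "EJ (\<lambda>x y u z. log 2 (Jxuz x u z / (Jxu x u * Jz z)))
      - EJ (\<lambda>x y u z. log 2 (pmf px1 x * pmf (W2 x) y * pmf (pu y) u * pmf px1 x
          / (Jxu x u * (pmf px1 x * pmf (W2 x) y)))) = I_joint - I_cover"
    unfolding I_joint_def I_cover_def EJ_def sum_subtractf[symmetric] right_diff_distrib[symmetric]
  proof (intro sum.cong refl)
    fix x y u z
    show "J x y u z * (log 2 (Jxuz x u z / (Jxu x u * Jz z)) -
        log 2 (pmf px1 x * pmf (W2 x) y * pmf (pu y) u * pmf px1 x / (Jxu x u * (pmf px1 x * pmf (W2 x) y))))
      = J x y u z * (log 2 (Jxuz x u z / (pmf px1 x * Ju u * Jz z)) - log 2 (pmf (pu y) u / Ju u))"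
    proof (cases "J x y u z = 0")
      case False
      have "pmf (W2 x) y \<noteq> 0"
        using False by (auto simp: J_def)
      then have "0 < pmf (W2 x) y"
        by (simp add: less_le)
      then show ?thesis
        using marginals_pos[OF False] Jxu_pos[OF False] by (simp add: log_divide log_mult)
    qed simp
  qed
  ultimately show ?thesis
    by simp
qed

text \<open>Lookahead enters here: \<open>g\<close> reads the entire received sequence to choose the
  relay word, after which \<open>f\<close> acts letter by letter on that word and on the current
  output.\<close>

lemma relay_error_seqs:
  "relay_error W2 W3 n M c (\<lambda>y2 i. f (g (\<lambda>i\<in>{..<n}. y2 ! i) i) (y2 ! i)) (\<lambda>y3. \<delta> (\<lambda>i\<in>{..<n}. y3 ! i))
    = 1 / M * (\<Sum>m\<in>{1..M}. \<Sum>y\<in>seqs n. \<Sum>z\<in>seqs n. (\<Prod>i<n. pmf (W2 (c m i)) (y i)) *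
      (\<Prod>i<n. pmf (W3 (c m i) (f (g y i) (y i)) (y i)) (z i)) * of_bool (\<delta> z \<noteq> m))"
proof -
  have "(\<Sum>y\<in>seqs n. \<Sum>z\<in>seqs n. (\<Prod>i<n. pmf (W2 (c m i)) (y i)) *
      (\<Prod>i<n. pmf (W3 (c m i) (f (g y i) (y i)) (y i)) (z i)) * of_bool (\<delta> z \<noteq> m))
    = (\<Sum>y2\<in>{ys. length ys = n}. \<Sum>y3\<in>{ys. length ys = n}.
          (\<Prod>i<n. pmf (W2 (c m i)) (y2 ! i)) *
          (\<Prod>i<n. pmf (W3 (c m i) (f (g (\<lambda>i\<in>{..<n}. y2 ! i) i) (y2 ! i)) (y2 ! i)) (y3 ! i)) *
          (if \<delta> (\<lambda>i\<in>{..<n}. y3 ! i) = m then 0 else 1))" for m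
    unfolding sum_lists_eq_sum_seqs[symmetric] by (intro sum.cong refl arg_cong2[where f = "(*)"] prod.cong) auto
  then show ?thesis
    unfolding relay_error_def by simp
qed

theorem achievable:
  assumes "0 \<le> R" "R < I_direct" "R < I_joint - I_cover"
  shows "relay_achievable W2 W3 R"
proof -
  define err where "err = (\<lambda>n (c :: nat \<Rightarrow> nat \<Rightarrow> 'x1) (g :: (nat \<Rightarrow> 'y2) \<Rightarrow> nat \<Rightarrow> 'u) (\<delta> :: (nat \<Rightarrow> 'y3) \<Rightarrow> nat).
    relay_error W2 W3 n (num_messages R n) c (\<lambda>y2 i. f (g (\<lambda>i\<in>{..<n}. y2 ! i) i) (y2 ! i)) (\<lambda>y3. \<delta> (\<lambda>i\<in>{..<n}. y3 ! i)))"
  obtain b where b: "b \<longlonglongrightarrow> 0" "\<And>n. \<exists>c g \<delta>. err n c g \<delta> \<le> b n"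
    using codes_exist[OF assms] unfolding err_def relay_error_seqs by blast
  then obtain c g \<delta> where le: "\<And>n. err n (c n) (g n) (\<delta> n) \<le> b n"
    by metis
  have "0 \<le> err n (c n) (g n) (\<delta> n)" for n
    unfolding err_def relay_error_def
    by (intro mult_nonneg_nonneg sum_nonneg prod_nonneg) auto
  then have "(\<lambda>n. err n (c n) (g n) (\<delta> n)) \<longlonglongrightarrow> 0"
    using le b(1) by (intro tendsto_sandwich[OF _ _ tendsto_const b(1)]) auto
  then show ?thesis
    unfolding relay_achievable_def err_def using assms(1)
    by (intro conjI exI[of _ c] exI[of _ "\<lambda>n y2 i. f (g n (\<lambda>i\<in>{..<n}. y2 ! i) i) (y2 ! i)"]
        exI[of _ "\<lambda>n y3. \<delta> n (\<lambda>i\<in>{..<n}. y3 ! i)"])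
qed

end

text \<open>Rate 0 means a single message, and a constant decoder always gives it. This handles a
  negative lower bound, as the difference of informations may be, since achievable rates are
  nonnegative by definition.\<close>

lemma relay_achievable_zero: "relay_achievable W2 W3 0"
  unfolding relay_achievable_def
proof (intro conjI exI)
  show "(\<lambda>n. relay_error W2 W3 n (num_messages 0 n) undefined undefined (\<lambda>_. 1)) \<longlonglongrightarrow> 0"
    by (simp add: relay_error_def num_messages_def)
qed simp

theorem theorem2:
  fixes W2 :: "'x1::finite \<Rightarrow> 'y2::finite pmf"
    and W3 :: "'x1 \<Rightarrow> 'x2::finite \<Rightarrow> 'y2 \<Rightarrow> 'y3::finite pmf"
    and px1 :: "'x1 pmf"
    and pu :: "'y2 \<Rightarrow> 'u::finite pmf"
    and f :: "'u \<Rightarrow> 'y2 \<Rightarrow> 'x2"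
  shows "ereal (min
           (mutual_info (relay_joint W2 W3 px1 pu f)
              (\<lambda>(x1, y2, u, x2, y3). x1) (\<lambda>(x1, y2, u, x2, y3). (u, y3)))
           (mutual_info (relay_joint W2 W3 px1 pu f)
              (\<lambda>(x1, y2, u, x2, y3). (x1, u)) (\<lambda>(x1, y2, u, x2, y3). y3)
            - cond_mutual_info (relay_joint W2 W3 px1 pu f)
              (\<lambda>(x1, y2, u, x2, y3). u) (\<lambda>(x1, y2, u, x2, y3). y2) (\<lambda>(x1, y2, u, x2, y3). x1)))
         \<le> relay_capacity W2 W3"
proof -
  interpret dm_relay W2 W3 px1 pu f .
  let ?I = "min I_direct (I_joint - I_cover)"
  have cap: "ereal R \<le> relay_capacity W2 W3" if "relay_achievable W2 W3 R" for R
    unfolding relay_capacity_def using that by (intro Sup_upper) auto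
  have "ereal ?I \<le> relay_capacity W2 W3"
  \<comment> \<open>Codes exist for rates strictly below the bound, so the capacity is compared with
    every smaller value.\<close>
  proof (rule dense_le)
    fix e assume "e < ereal ?I"
    from ereal_dense2[OF this] obtain R where R: "e < ereal R" "R < ?I"
      by (elim exE conjE) (simp only: less_ereal.simps)
    \<comment> \<open>The rate \<open>R\<close> may be negative, in which case rate 0 takes its
      place.\<close>
    have "relay_achievable W2 W3 (max R 0)"
      using R(2) relay_achievable_zero achievable[of R] by (auto simp: max_def)
    then have "ereal R \<le> relay_capacity W2 W3"
      using cap[of "max R 0"] by (meson ereal_less_eq(3) max.cobounded1 order_trans)
    with R(1) show "e \<le> relay_capacity W2 W3"
      by (meson less_imp_le order_trans)
  qed
  then show ?thesis
    unfolding mutual_info_direct mutual_info_relay .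
qed

end
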